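(* Let $0<\alpha<\beta<1$ and let $(L_{1+\beta}(t))_{t\ge0}$ be a $(1+\beta)$-stable Lévy process totally skewed to the right. The process $$\zeta_t=\int_{[0,t]}u^{\frac{\alpha}{1+\beta}}(t-u)^\alpha\,L_{1+\beta}(du),\qquad t\ge0,$$ has a modification with continuous sample paths, and it is self-similar with index $H=\frac{1+\alpha(2+\beta)}{1+\beta}$.
   Context: $L_{1+\beta}$ is the càdlàg Lévy process with $E e^{i\theta L_{1+\beta}(1)}=\exp\{-|\theta|^{1+\beta}(1-i(\mathrm{sgn}\,\theta)\tan\frac{\pi(1+\beta)}{2})\}$, $\theta\in\mathbb R$. Integrals $\int g(u)L_{1+\beta}(du)$ of deterministic $g$ with $\int|g|^{1+\beta}du<\infty$ are the usual stable integrals (with respect to the $(1+\beta)$-stable random measure with Lebesgue control measure and skewness intensity $1$). Self-similarity with index $H$ means that for every $a>0$ the processes $(\zeta_{at})_{t\ge0}$ and $(a^H\zeta_t)_{t\ge0}$ have the same finite dimensional distributions. *)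

theory Defs
  imports "HOL-Probability.Probability"
begin

text \<open>
  Stochastic processes indexed by \<open>[0, \<infinity>)\<close> are functions \<open>real \<Rightarrow> 'a \<Rightarrow> real\<close>, of which only
  the values at times \<open>t \<ge> 0\<close> are meaningful.
\<close>

definition cadlag :: "(real \<Rightarrow> real) \<Rightarrow> bool" where
  "cadlag x \<longleftrightarrow>
     (\<forall>t\<ge>0. (x \<longlongrightarrow> x t) (at_right t)) \<and> (\<forall>t>0. \<exists>l. (x \<longlongrightarrow> l) (at_left t))"

text \<open>
  Stochastic continuity is not listed among the axioms: it follows from stationarity of the
  increments and right-continuity of the paths.
\<close>

locale levy_process = prob_space M for M :: "'a measure" +
  fixes L :: "real \<Rightarrow> 'a \<Rightarrow> real"
  assumes measurable_L: "\<And>t. 0 \<le> t \<Longrightarrow> L t \<in> borel_measurable M"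
    and start_zero: "AE \<omega> in M. L 0 \<omega> = 0"
    and indep_increments:
      "\<And>(t :: nat \<Rightarrow> real) n. 0 \<le> t 0 \<Longrightarrow> (\<And>i. i < n \<Longrightarrow> t i \<le> t (Suc i)) \<Longrightarrow>
         indep_vars (\<lambda>_. borel) (\<lambda>i \<omega>. L (t (Suc i)) \<omega> - L (t i) \<omega>) {..<n}"
    and stationary_increments:
      "\<And>s h. 0 \<le> s \<Longrightarrow> 0 \<le> h \<Longrightarrow>
         distr M borel (\<lambda>\<omega>. L (s + h) \<omega> - L s \<omega>) = distr M borel (L h)"
    and cadlag_paths: "AE \<omega> in M. cadlag (\<lambda>t. L t \<omega>)"

text \<open>
  Index \<open>p \<in> (1, 2)\<close>, unit scale, skewness \<open>1\<close> (totally skewed to the right) and zero shift,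
  i.e. \<open>L 1\<close> has the law \<open>S\<^sub>p(1, 1, 0)\<close>.
\<close>

locale right_skewed_stable_levy_process = levy_process M L
  for M :: "'a measure" and L :: "real \<Rightarrow> 'a \<Rightarrow> real" +
  fixes p :: real
  assumes index: "1 < p" "p < 2"
    and char_L1: "\<And>\<theta> :: real. char (distr M borel (L 1)) \<theta> =
        exp (- (of_real (\<bar>\<theta>\<bar> powr p) * (1 - \<i> * of_real (sgn \<theta> * tan (pi * p / 2)))))"

definition tendsto_in_probability ::
    "'a measure \<Rightarrow> (nat \<Rightarrow> 'a \<Rightarrow> real) \<Rightarrow> ('a \<Rightarrow> real) \<Rightarrow> bool" where
  "tendsto_in_probability M X Y \<longleftrightarrow>
     (\<forall>\<epsilon>>0. (\<lambda>n. measure M {\<omega> \<in> space M. \<epsilon> < \<bar>X n \<omega> - Y \<omega>\<bar>}) \<longlonglongrightarrow> 0)"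

text \<open>
  A list of triples \<open>(c, a, b)\<close> encodes the step function \<open>\<Sum> c 1\<^bsub>(a, b]\<^esub>\<close>; the intervals may
  overlap. The stable random measure induced by \<open>L\<close> assigns \<open>L b - L a\<close> to \<open>(a, b]\<close>; it has
  Lebesgue control measure and skewness intensity \<open>1\<close> when \<open>L\<close> is as above.
\<close>

definition valid_steps :: "(real \<times> real \<times> real) list \<Rightarrow> bool" where
  "valid_steps xs \<longleftrightarrow> (\<forall>(c, a, b) \<in> set xs. 0 \<le> a \<and> a \<le> b)"

definition step_fun :: "(real \<times> real \<times> real) list \<Rightarrow> real \<Rightarrow> real" where
  "step_fun xs u = (\<Sum>(c, a, b)\<leftarrow>xs. c * indicat_real {a<..b} u)"

definition step_integral ::
    "(real \<Rightarrow> 'a \<Rightarrow> real) \<Rightarrow> (real \<times> real \<times> real) list \<Rightarrow> 'a \<Rightarrow> real" where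
  "step_integral L xs \<omega> = (\<Sum>(c, a, b)\<leftarrow>xs. c * (L b \<omega> - L a \<omega>))"

text \<open>
  The integral of a deterministic \<open>g\<close> over \<open>A \<subseteq> [0, \<infinity>)\<close> is the limit in probability of the
  integrals of step functions converging to \<open>1\<^sub>A g\<close> in \<open>L\<^sup>p\<close>. The limit does not depend on the
  approximating sequence and is unique up to null sets; an approximating sequence exists
  precisely when \<open>\<integral>\<^sub>A \<bar>g\<bar>\<^sup>p du < \<infinity>\<close>.
\<close>

definition has_stable_integral ::
    "'a measure \<Rightarrow> real \<Rightarrow> (real \<Rightarrow> 'a \<Rightarrow> real) \<Rightarrow> real set \<Rightarrow> (real \<Rightarrow> real) \<Rightarrow> ('a \<Rightarrow> real) \<Rightarrow> bool"
  where
  "has_stable_integral M p L A g Y \<longleftrightarrow>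
     set_borel_measurable lborel A g \<and> Y \<in> borel_measurable M \<and>
     (\<exists>xs :: nat \<Rightarrow> (real \<times> real \<times> real) list.
        (\<forall>n. valid_steps (xs n)) \<and>
        (\<lambda>n. \<integral>\<^sup>+u. ennreal (\<bar>indicat_real A u * g u - step_fun (xs n) u\<bar> powr p) \<partial>lborel)
          \<longlonglongrightarrow> 0 \<and>
        tendsto_in_probability M (\<lambda>n. step_integral L (xs n)) Y)"

definition stable_integral ::
    "'a measure \<Rightarrow> real \<Rightarrow> (real \<Rightarrow> 'a \<Rightarrow> real) \<Rightarrow> real set \<Rightarrow> (real \<Rightarrow> real) \<Rightarrow> 'a \<Rightarrow> real" where
  "stable_integral M p L A g = (SOME Y. has_stable_integral M p L A g Y)"

definition is_modification ::
    "'a measure \<Rightarrow> (real \<Rightarrow> 'a \<Rightarrow> real) \<Rightarrow> (real \<Rightarrow> 'a \<Rightarrow> real) \<Rightarrow> bool" where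
  "is_modification M X Y \<longleftrightarrow>
     (\<forall>t\<ge>0. Y t \<in> borel_measurable M \<and> (AE \<omega> in M. Y t \<omega> = X t \<omega>))"

definition fin_dim_distr ::
    "'a measure \<Rightarrow> (real \<Rightarrow> 'a \<Rightarrow> real) \<Rightarrow> real set \<Rightarrow> (real \<Rightarrow> real) measure" where
  "fin_dim_distr M X J = distr M (PiM J (\<lambda>_. borel)) (\<lambda>\<omega>. \<lambda>t\<in>J. X t \<omega>)"

definition self_similar :: "'a measure \<Rightarrow> real \<Rightarrow> (real \<Rightarrow> 'a \<Rightarrow> real) \<Rightarrow> bool" where
  "self_similar M H X \<longleftrightarrow>
     (\<forall>a>0. \<forall>J. finite J \<longrightarrow> J \<subseteq> {0..} \<longrightarrow>
        fin_dim_distr M (\<lambda>t. X (a * t)) J = fin_dim_distr M (\<lambda>t \<omega>. a powr H * X t \<omega>) J)"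

end

theory Submission
  imports Defs
begin

text \<open>
  Since \<open>\<alpha> > 0\<close>, the integrand vanishes at both ends of \<open>[0, t]\<close> and has an integrable derivative.
  Integration by parts therefore turns \<open>\<zeta>\<^sub>t\<close> into an ordinary integral of the path of \<open>L\<close> which,
  after the substitution \<open>u = t v\<close>, reads \<open>- t\<^bsup>a + b\<^esup> \<integral>\<^sub>0\<^sup>1 k'(v) L(t v) dv\<close> with
  \<open>k(v) = v\<^bsup>a\<^esup> (1 - v)\<^bsup>b\<^esup>\<close>, \<open>a = \<alpha> / (1 + \<beta>)\<close> and \<open>b = \<alpha>\<close>. A cadlag path is locally bounded and has
  only countably many jumps, so dominated convergence makes this continuous in \<open>t\<close>; no moment estimate
  is needed. The Riemann sums converge to it on every cadlag path and their integrands converge in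
  \<open>L\<^sup>p\<close>, and the characteristic function of a step integral shows that the limit in probability does
  not depend on the approximating step functions. Finally, the increments of \<open>L(c t)\<close> on a partition
  have the same joint law as those of \<open>c\<^bsup>1/p\<^esup> L(t)\<close>; this passes to the Riemann sums and to their
  limits, and the powers of \<open>c\<close> add up to \<open>a + b + 1 / p\<close>.
\<close>

subsection \<open>Characteristic functions of the increments\<close>

text \<open>\<open>stable_integral\<close> is a \<open>SOME\<close> choice, so nothing can be read
  off \<zeta> directly. The Riemann sums show that an integral exists, uniqueness identifies it
  almost surely with the chosen one at each fixed time, and from then on only almost sure limits of
  Riemann sums are used. Uniqueness must turn smallness of the integrand in \<open>L^p\<close> into
  smallness in probability, while the only law given is that of \<open>L 1\<close>; hence the law of
  \<open>L t\<close> is recovered first at times 1/n, then at rational times, then at all times by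
  right-continuity. The kernel is sampled at the left ends of the grid cells. Summation by parts
  then evaluates the path at the right ends, and right-continuity gives convergence at every point,
  jumps included. Riemann sums for several times live on different grids, so their joint laws are
  compared on a common refinement. The passage to the limit uses almost sure convergence of each
  coordinate and bounded continuous test functions.\<close>

definition stable_exponent :: "real \<Rightarrow> real \<Rightarrow> complex" where
  "stable_exponent p \<theta> =
     of_real (\<bar>\<theta>\<bar> powr p) * (1 - \<i> * of_real (sgn \<theta> * tan (pi * p / 2)))"

text \<open>The factor \<open>sgn\<close> jumps at 0. Writing its product with the power as the
  difference of the p-th powers of the positive and negative parts removes the jump.\<close>

lemma continuous_on_stable_exponent:
  assumes "0 < p"
  shows "continuous_on A (stable_exponent p)"
proof -
  have eq: "stable_exponent p = (\<lambda>\<theta>. of_real (\<bar>\<theta>\<bar> powr p)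
      - \<i> * of_real ((max \<theta> 0 powr p - max (- \<theta>) 0 powr p) * tan (pi * p / 2)))"
    using assms by (auto simp: stable_exponent_def sgn_if fun_eq_iff algebra_simps max_def)
  show ?thesis unfolding eq
    by (intro continuous_intros continuous_on_powr') (use assms in auto)
qed

lemma stable_exponent_0 [simp]: "stable_exponent p 0 = 0"
  by (simp add: stable_exponent_def)

lemma norm_stable_exponent_le:
  "cmod (stable_exponent p \<theta>) \<le> (1 + \<bar>tan (pi * p / 2)\<bar>) * \<bar>\<theta>\<bar> powr p"
proof -
  have "cmod (1 - \<i> * of_real (sgn \<theta> * tan (pi * p / 2))) \<le> cmod 1 + cmod (\<i> * of_real (sgn \<theta> * tan (pi * p / 2)))"
    by (rule norm_triangle_ineq4)
  also have "\<dots> \<le> 1 + \<bar>tan (pi * p / 2)\<bar>"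
    by (simp add: norm_mult abs_mult sgn_if)
  finally show ?thesis
    unfolding stable_exponent_def norm_mult by (subst mult.commute) (simp add: mult_right_mono)
qed

lemma Re_stable_exponent: "Re (stable_exponent p \<theta>) = \<bar>\<theta>\<bar> powr p"
  by (simp add: stable_exponent_def)

lemma stable_exponent_scale:
  assumes "0 < c"
  shows "stable_exponent p (c * \<theta>) = of_real (c powr p) * stable_exponent p \<theta>"
  using assms by (simp add: stable_exponent_def abs_mult powr_mult sgn_mult)

text \<open>Mean value inequality on the closed left half-plane, which is convex and on which the
  derivative of \<open>exp\<close> has modulus at most 1.\<close>

lemma norm_exp_minus_one_le:
  fixes z :: complex
  assumes "Re z \<le> 0"
  shows "cmod (exp z - 1) \<le> cmod z"
proof -
  have "cmod (exp z - exp 0) \<le> 1 * cmod (z - 0)"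
  proof (rule field_differentiable_bound)
    show "convex {w :: complex. Re w \<le> 0}"
      by (rule convex_halfspace_Re_le)
    show "(exp has_field_derivative exp w) (at w within {w. Re w \<le> 0})" for w :: complex
      by (rule derivative_eq_intros refl)+ simp
  qed (use assms in auto)
  then show ?thesis by simp
qed

lemma (in levy_process) char_increment:
  assumes "0 \<le> s" "s \<le> t"
  shows "char (distr M borel (\<lambda>\<omega>. L t \<omega> - L s \<omega>)) = char (distr M borel (L (t - s)))"
  using stationary_increments[of s "t - s"] assms by simp

lemma (in levy_process) increment_measurable:
  assumes "0 \<le> s" "s \<le> t"
  shows "(\<lambda>\<omega>. L t \<omega> - L s \<omega>) \<in> borel_measurable M"
  using measurable_L assms by auto

lemma (in levy_process) real_distribution_L:
  assumes "0 \<le> t"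
  shows "real_distribution (distr M borel (L t))"
  using assms by (intro real_distribution_distr measurable_L)

lemma (in levy_process) char_L_multiple:
  assumes "0 \<le> h"
  shows "char (distr M borel (L (of_nat n * h))) \<theta> = char (distr M borel (L h)) \<theta> ^ n"
proof -
  \<comment> \<open>\<open>L 0\<close> vanishes only almost surely, so the telescoping sum agrees
    with \<open>L (of_nat n * h)\<close> only up to a null set; that is enough for equal
    laws.\<close>
  have "distr M borel (L (of_nat n * h)) =
      distr M borel (\<lambda>\<omega>. \<Sum>i<n. L (of_nat (Suc i) * h) \<omega> - L (of_nat i * h) \<omega>)"
    using start_zero assms measurable_L
    by (intro distr_cong_AE)
       (auto simp: sum_lessThan_telescope[of "\<lambda>i. L (of_nat i * h) _"] simp del: of_nat_Suc)
  moreover have "indep_vars (\<lambda>_. borel) (\<lambda>i \<omega>. L (of_nat (Suc i) * h) \<omega> - L (of_nat i * h) \<omega>) {..<n}"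
    using indep_increments[of "\<lambda>i. of_nat i * h" n] assms by (simp add: mult_right_mono)
  moreover have "char (distr M borel (\<lambda>\<omega>. L (of_nat (Suc i) * h) \<omega> - L (of_nat i * h) \<omega>)) \<theta>
      = char (distr M borel (L h)) \<theta>" for i
    using char_increment[of "of_nat i * h" "of_nat (Suc i) * h"] assms
    by (simp add: algebra_simps)
  ultimately show ?thesis
    by (simp add: char_distr_sum del: of_nat_Suc)
qed

context right_skewed_stable_levy_process
begin

text \<open>
  The quotient of the two sides is continuous in \<open>\<theta>\<close>, equals \<open>1\<close> at \<open>0\<close> and takes values in the
  \<open>n\<close>-th roots of unity, so it is constant.
\<close>

lemma char_L_inverse_nat:
  assumes n: "0 < n"
  shows "char (distr M borel (L (1 / of_nat n))) \<theta> = exp (- (stable_exponent p \<theta> / of_nat n))"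
proof -
  interpret D: real_distribution "distr M borel (L (1 / of_nat n))"
    by (rule real_distribution_L) simp
  define r where "r \<theta> = char (distr M borel (L (1 / of_nat n))) \<theta> * exp (stable_exponent p \<theta> / of_nat n)" for \<theta>
  have pow: "r \<theta> ^ n = 1" for \<theta>
  proof -
    have "char (distr M borel (L (1 / of_nat n))) \<theta> ^ n = exp (- stable_exponent p \<theta>)"
      using char_L_multiple[of "1 / of_nat n" n \<theta>] n char_L1[of \<theta>] by (simp add: stable_exponent_def)
    moreover have "exp (stable_exponent p \<theta> / of_nat n) ^ n = exp (stable_exponent p \<theta>)"
      using n by (simp add: exp_of_nat_mult[symmetric])
    ultimately show ?thesis
      by (simp add: r_def power_mult_distrib exp_minus_inverse mult.commute)
  qed
  have cont: "continuous_on UNIV r"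
    unfolding r_def using D.isCont_char index n
    by (intro continuous_intros continuous_on_stable_exponent)
       (auto intro!: continuous_at_imp_continuous_on)
  have "r constant_on UNIV"
  proof (rule continuous_finite_range_constant[OF _ cont])
    show "finite (range r)"
      by (rule finite_subset[OF _ finite_roots_unity[of n]]) (use pow n in auto)
  qed auto
  then have "r \<theta> = r 0"
    by (auto simp: constant_on_def)
  also have "\<dots> = 1"
    by (simp add: r_def D.char_zero)
  finally show ?thesis
    by (simp add: r_def exp_minus field_simps)
qed

lemma char_L_rational:
  assumes n: "0 < n"
  shows "char (distr M borel (L (of_nat m / of_nat n))) \<theta>
    = exp (- (of_real (of_nat m / of_nat n) * stable_exponent p \<theta>))"
  using char_L_multiple[of "1 / of_nat n" m \<theta>] char_L_inverse_nat[OF n, of \<theta>]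
  by (simp add: exp_of_nat_mult[symmetric])

end

text \<open>The least multiple of 1/(n+1) strictly above \<open>v\<close>. Strictness makes the
  approach genuinely from the right, even when \<open>v\<close> is itself a grid point, so
  right-continuity applies everywhere.\<close>

definition upper_grid :: "nat \<Rightarrow> real \<Rightarrow> real" where
  "upper_grid n v = (of_int \<lfloor>v * of_nat (Suc n)\<rfloor> + 1) / of_nat (Suc n)"

lemma upper_grid_gt: "v < upper_grid n v"
proof -
  have "v * of_nat (Suc n) < of_int \<lfloor>v * of_nat (Suc n)\<rfloor> + 1"
    by linarith
  then show ?thesis
    unfolding upper_grid_def by (simp add: less_divide_eq del: of_nat_Suc)
qed

lemma upper_grid_tendsto: "filterlim (\<lambda>n. upper_grid n v) (at_right v) sequentially"
proof -
  have le: "upper_grid n v \<le> v + 1 / of_nat (Suc n)" for n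
  proof -
    have "of_int \<lfloor>v * of_nat (Suc n)\<rfloor> + 1 \<le> v * of_nat (Suc n) + 1"
      by linarith
    then show ?thesis
      unfolding upper_grid_def by (simp add: field_simps del: of_nat_Suc)
  qed
  have "(\<lambda>n. v + 1 / of_nat (Suc n)) \<longlonglongrightarrow> v + 0"
    by (intro tendsto_intros LIMSEQ_Suc lim_1_over_n)
  then have "(\<lambda>n. upper_grid n v) \<longlonglongrightarrow> v"
    using le upper_grid_gt[of v]
    by (intro tendsto_sandwich[of "\<lambda>_. v" "\<lambda>n. upper_grid n v"])
       (auto intro: less_imp_le always_eventually)
  then show ?thesis
    using upper_grid_gt[of v] by (auto simp: filterlim_at order_less_imp_not_eq2)
qed

context right_skewed_stable_levy_process
begin

text \<open>The rational times \<open>upper_grid n t\<close> decrease to \<open>t\<close> from the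
  right in the sense of \<open>at_right\<close>; right-continuous paths and dominated convergence
  carry the rational formula over.\<close>

lemma char_L:
  assumes t: "0 \<le> t"
  shows "char (distr M borel (L t)) \<theta> = exp (- (of_real t * stable_exponent p \<theta>))"
proof -
  define s where "s n = upper_grid n t" for n
  have lim: "filterlim s (at_right t) sequentially"
    using upper_grid_tendsto[of t] by (simp add: s_def[abs_def])
  have s_pos: "0 \<le> s n" for n
    using t upper_grid_gt[of t n] by (simp add: s_def)
  have s_rat: "char (distr M borel (L (s n))) \<theta> = exp (- (of_real (s n) * stable_exponent p \<theta>))" for n
  proof -
    have "s n = of_nat (nat (\<lfloor>t * of_nat (Suc n)\<rfloor> + 1)) / of_nat (Suc n)"
      using t by (simp add: s_def upper_grid_def)
    then show ?thesis
      using char_L_rational[of "Suc n" "nat (\<lfloor>t * of_nat (Suc n)\<rfloor> + 1)" \<theta>] by simp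
  qed
  have "(\<lambda>n. CLINT \<omega>|M. iexp (\<theta> * L (s n) \<omega>)) \<longlonglongrightarrow> (CLINT \<omega>|M. iexp (\<theta> * L t \<omega>))"
  proof (rule integral_dominated_convergence[where w="\<lambda>_. 1"])
    show "AE \<omega> in M. (\<lambda>n. iexp (\<theta> * L (s n) \<omega>)) \<longlonglongrightarrow> iexp (\<theta> * L t \<omega>)"
      using cadlag_paths
    proof eventually_elim
      case (elim \<omega>)
      then have "(\<lambda>n. L (s n) \<omega>) \<longlonglongrightarrow> L t \<omega>"
        using lim t by (auto simp: cadlag_def intro: filterlim_compose[where g="\<lambda>t. L t \<omega>"])
      then show ?case
        by (intro tendsto_intros)
    qed
  qed (use measurable_L s_pos t in auto)
  then have "(\<lambda>n. char (distr M borel (L (s n))) \<theta>) \<longlonglongrightarrow> char (distr M borel (L t)) \<theta>"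
    using measurable_L s_pos t by (simp add: char_def integral_distr)
  moreover have "(\<lambda>n. char (distr M borel (L (s n))) \<theta>) \<longlonglongrightarrow> exp (- (of_real t * stable_exponent p \<theta>))"
    unfolding s_rat using lim by (intro tendsto_intros) (simp add: filterlim_at)
  ultimately show ?thesis
    by (rule LIMSEQ_unique)
qed

end

subsection \<open>Step integrals\<close>

text \<open>Supplies one partition that cuts all intervals of a step list, or of finitely many such
  lists. The sequence is constant beyond \<open>n\<close>, so monotonicity holds without index
  bounds; inserting 0 keeps the list nonempty.\<close>

lemma finite_subset_range_mono:
  fixes F :: "real set"
  assumes "finite F" "F \<subseteq> {0..}"
  obtains t :: "nat \<Rightarrow> real" and n where "mono t" "0 \<le> t 0" "F \<subseteq> t ` {..n}"
proof -
  define ts where "ts = sorted_list_of_set (insert 0 F)"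
  have ts: "sorted ts" "set ts = insert 0 F" "ts \<noteq> []"
  proof -
    have "finite (insert 0 F)"
      using assms by simp
    then show "sorted ts" "set ts = insert 0 F"
      unfolding ts_def using sorted_sorted_list_of_set set_sorted_list_of_set by blast+
    then show "ts \<noteq> []"
      by auto
  qed
  define n where "n = length ts - 1"
  define t where "t i = ts ! min i n" for i
  have "mono t"
    using ts by (auto simp: mono_def t_def n_def intro!: sorted_nth_mono min.strict_coboundedI2)
  moreover have "0 \<le> t 0"
    using ts assms by (metis atLeast_iff insert_iff length_greater_0_conv min_0L nth_mem order_refl subset_iff t_def)
  moreover have "F \<subseteq> t ` {..n}"
  proof
    fix x assume "x \<in> F"
    then obtain i where "i < length ts" "x = ts ! i"
      using ts by (metis in_set_conv_nth insertCI)
    then show "x \<in> t ` {..n}"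
      by (intro image_eqI[of _ _ i]) (auto simp: t_def n_def)
  qed
  ultimately show ?thesis
    by (rule that)
qed

definition breakpoints :: "(real \<times> real \<times> real) list \<Rightarrow> real set" where
  "breakpoints xs = (\<Union>(c, a, b)\<in>set xs. {a, b})"

lemma finite_breakpoints: "finite (breakpoints xs)"
  by (auto simp: breakpoints_def)

lemma breakpoints_nonneg: "valid_steps xs \<Longrightarrow> breakpoints xs \<subseteq> {0..}"
  by (force simp: breakpoints_def valid_steps_def)

lemma valid_steps_Cons:
  "valid_steps ((c, a, b) # xs) \<longleftrightarrow> 0 \<le> a \<and> a \<le> b \<and> valid_steps xs"
  by (simp add: valid_steps_def)

lemma breakpoints_Cons: "breakpoints ((c, a, b) # xs) = {a, b} \<union> breakpoints xs"
  by (simp add: breakpoints_def)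

lemma diff_eq_sum_partition:
  fixes t :: "nat \<Rightarrow> real" and f :: "real \<Rightarrow> real"
  assumes t: "mono t" and "a \<in> t ` {..n}" "b \<in> t ` {..n}" "a \<le> b"
  shows "f b - f a = (\<Sum>i<n. indicat_real {a<..b} (t (Suc i)) * (f (t (Suc i)) - f (t i)))"
proof -
  obtain j k where jk: "a = t j" "b = t k" "j \<le> n" "k \<le> n"
    using assms by auto
  \<comment> \<open>Repeated points may yield indices in the wrong order. Then monotonicity forces
    \<open>a = b\<close>, and one index serves for both.\<close>
  have "\<exists>j k. a = t j \<and> b = t k \<and> j \<le> k \<and> k \<le> n"
    using jk assms(4) t by (metis antisym monoD nat_le_linear)
  then obtain j k where jk: "a = t j" "b = t k" "j \<le> k" "k \<le> n"
    by blast
  have "(\<Sum>i<n. indicat_real {a<..b} (t (Suc i)) * (f (t (Suc i)) - f (t i)))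
      = (\<Sum>i<n. if i \<in> {j..<k} then f (t (Suc i)) - f (t i) else 0)"
  proof (rule sum.cong[OF refl])
    fix i
    \<comment> \<open>A nondegenerate cell lies in \<open>(a, b]\<close> exactly when its right end
      does. The indicator may be wrong on a degenerate cell, but there the increment is
      zero.\<close>
    have "t i \<le> t (Suc i)" "i < j \<Longrightarrow> t (Suc i) \<le> a" "i \<ge> j \<Longrightarrow> a \<le> t i"
      "i < k \<Longrightarrow> t (Suc i) \<le> b" "i \<ge> k \<Longrightarrow> b \<le> t i"
      using t jk by (auto simp: mono_def)
    then show "indicat_real {a<..b} (t (Suc i)) * (f (t (Suc i)) - f (t i))
      = (if i \<in> {j..<k} then f (t (Suc i)) - f (t i) else 0)"
      by (cases "t i = t (Suc i)") (auto simp: indicator_def)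
  qed
  also have "\<dots> = (\<Sum>i\<in>{j..<k}. f (t (Suc i)) - f (t i))"
    using jk by (subst sum.inter_restrict[symmetric]) (auto intro!: sum.cong)
  also have "\<dots> = f b - f a"
    using sum_Suc_diff'[of j k "\<lambda>i. f (t i)"] jk by simp
  finally show ?thesis by simp
qed

lemma step_integral_eq_sum_partition:
  assumes "mono t" "valid_steps xs" "breakpoints xs \<subseteq> t ` {..n}"
  shows "step_integral L xs \<omega> = (\<Sum>i<n. step_fun xs (t (Suc i)) * (L (t (Suc i)) \<omega> - L (t i) \<omega>))"
  using assms(2,3)
proof (induction xs)
  case Nil
  then show ?case by (simp add: step_integral_def step_fun_def)
next
  case (Cons x xs)
  obtain c a b where x: "x = (c, a, b)" by (cases x)
  have "step_integral L (x # xs) \<omega> = c * (L b \<omega> - L a \<omega>) + step_integral L xs \<omega>"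
    by (simp add: x step_integral_def)
  also have "c * (L b \<omega> - L a \<omega>) =
    c * (\<Sum>i<n. indicat_real {a<..b} (t (Suc i)) * (L (t (Suc i)) \<omega> - L (t i) \<omega>))"
    using diff_eq_sum_partition[of t a n b "\<lambda>s. L s \<omega>"] assms(1) Cons.prems
    by (simp add: x valid_steps_Cons breakpoints_Cons)
  also have "step_integral L xs \<omega> = (\<Sum>i<n. step_fun xs (t (Suc i)) * (L (t (Suc i)) \<omega> - L (t i) \<omega>))"
    using Cons by (simp add: x valid_steps_Cons breakpoints_Cons)
  finally show ?case
    by (simp add: x step_fun_def sum_distrib_left sum.distrib[symmetric] algebra_simps)
qed

lemma step_fun_const_partition:
  assumes t: "mono t" and "breakpoints xs \<subseteq> t ` {..n}" and u: "t i < u" "u \<le> t (Suc i)"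
  shows "step_fun xs u = step_fun xs (t (Suc i))"
proof -
  \<comment> \<open>No breakpoint lies strictly inside a cell. Membership in \<open>(a, b]\<close>
    means \<open>a < u\<close> and not \<open>b < u\<close>, so strict comparisons with breakpoints
    decide the value, and it is constant up to and including the right end.\<close>
  have *: "s < u \<longleftrightarrow> s < t (Suc i)" if "s \<in> breakpoints xs" for s
  proof -
    from that assms(2) obtain j where j: "s = t j" by auto
    show ?thesis
    proof (cases "j \<le> i")
      case True
      then have "s \<le> t i" using t j by (auto simp: mono_def)
      then show ?thesis using u by auto
    next
      case False
      then have "t (Suc i) \<le> s" using t j by (auto simp: mono_def)
      then show ?thesis using u by auto
    qed
  qed
  have "indicat_real {a<..b} u = indicat_real {a<..b} (t (Suc i))" if "(c, a, b) \<in> set xs" for c a b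
  proof -
    have "a \<in> breakpoints xs" "b \<in> breakpoints xs"
      using that by (auto simp: breakpoints_def)
    then show ?thesis
      using *[of a] *[of b] by (auto simp: indicator_def not_less[symmetric])
  qed
  then show ?thesis
    unfolding step_fun_def by (intro arg_cong[where f=sum_list] map_cong) auto
qed

lemma sum_indicator_partition:
  fixes t :: "nat \<Rightarrow> real"
  assumes "mono t"
  shows "(\<Sum>i<n. indicator {t i<..t (Suc i)} u) = (indicator {t 0<..t n} u :: ennreal)"
proof (induction n)
  case (Suc n)
  have "t 0 \<le> t n" "t n \<le> t (Suc n)" using assms by (auto simp: mono_def)
  then show ?case using Suc by (auto simp: indicator_def)
qed simp

text \<open>The sum is the integral over \<open>(t 0, t n]\<close>, which is bounded by the integral
  over the whole line. Only an upper bound enters the estimate of characteristic functions.\<close>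

lemma sum_partition_le_nn_integral:
  assumes t: "mono t" and "breakpoints xs \<subseteq> t ` {..n}"
  shows "ennreal (\<Sum>i<n. (t (Suc i) - t i) * \<bar>step_fun xs (t (Suc i))\<bar> powr p)
    \<le> (\<integral>\<^sup>+u. ennreal (\<bar>step_fun xs u\<bar> powr p) \<partial>lborel)"
proof -
  have le: "t i \<le> t (Suc i)" for i
    using t by (auto simp: mono_def)
  have "ennreal (\<Sum>i<n. (t (Suc i) - t i) * \<bar>step_fun xs (t (Suc i))\<bar> powr p)
    = (\<Sum>i<n. ennreal (\<bar>step_fun xs (t (Suc i))\<bar> powr p) * emeasure lborel {t i<..t (Suc i)})"
    using le by (subst sum_ennreal[symmetric]) (auto simp: ennreal_mult' mult.commute intro!: sum.cong)
  also have "\<dots> = (\<Sum>i<n. \<integral>\<^sup>+u. ennreal (\<bar>step_fun xs (t (Suc i))\<bar> powr p) * indicator {t i<..t (Suc i)} u \<partial>lborel)"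
    by (simp add: nn_integral_cmult_indicator)
  also have "\<dots> = (\<integral>\<^sup>+u. (\<Sum>i<n. ennreal (\<bar>step_fun xs (t (Suc i))\<bar> powr p) * indicator {t i<..t (Suc i)} u) \<partial>lborel)"
    by (rule nn_integral_sum[symmetric]) simp
  also have "\<dots> = (\<integral>\<^sup>+u. ennreal (\<bar>step_fun xs u\<bar> powr p) * (\<Sum>i<n. indicator {t i<..t (Suc i)} u) \<partial>lborel)"
    using step_fun_const_partition[OF assms]
    by (intro nn_integral_cong, subst sum_distrib_left, intro sum.cong) (auto split: split_indicator)
  also have "\<dots> \<le> (\<integral>\<^sup>+u. ennreal (\<bar>step_fun xs u\<bar> powr p) \<partial>lborel)"
    unfolding sum_indicator_partition[OF t] by (intro nn_integral_mono) (auto simp: indicator_def)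
  finally show ?thesis .
qed

context right_skewed_stable_levy_process
begin

lemma step_integral_measurable:
  assumes "valid_steps xs"
  shows "step_integral L xs \<in> borel_measurable M"
  using assms
proof (induction xs)
  case Nil
  then show ?case by (simp add: step_integral_def[abs_def])
next
  case (Cons x xs)
  obtain c a b where x: "x = (c, a, b)" by (cases x)
  have "step_integral L (x # xs) = (\<lambda>\<omega>. c * (L b \<omega> - L a \<omega>) + step_integral L xs \<omega>)"
    by (simp add: x step_integral_def fun_eq_iff)
  with Cons measurable_L[of a] measurable_L[of b] show ?case
    by (auto simp: x valid_steps_Cons)
qed

lemma char_increment_scaled:
  assumes "0 \<le> s" "s \<le> t"
  shows "char (distr M borel (\<lambda>\<omega>. c * (L t \<omega> - L s \<omega>))) \<theta>
    = exp (- (of_real (t - s) * stable_exponent p (c * \<theta>)))"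
proof -
  note [measurable] = increment_measurable[OF assms]
  have "char (distr M borel (\<lambda>\<omega>. c * (L t \<omega> - L s \<omega>))) \<theta> = char (distr M borel (\<lambda>\<omega>. L t \<omega> - L s \<omega>)) (c * \<theta>)"
    by (simp add: char_def integral_distr mult_ac)
  then show ?thesis
    using char_L[of "t - s"] assms by (simp add: char_increment)
qed

text \<open>Cut along a partition, overlapping steps become a linear combination of independent
  increments, so the characteristic functions multiply.\<close>

lemma char_step_integral:
  assumes t: "mono t" "0 \<le> t 0" and xs: "valid_steps xs" "breakpoints xs \<subseteq> t ` {..n}"
  shows "char (distr M borel (step_integral L xs)) \<theta>
    = exp (- (\<Sum>i<n. of_real (t (Suc i) - t i) * stable_exponent p (step_fun xs (t (Suc i)) * \<theta>)))"
proof -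
  have pos: "0 \<le> t i" "t i \<le> t (Suc i)" for i
    using t monoD[OF t(1), of 0 i] monoD[OF t(1), of i "Suc i"] by auto
  have "indep_vars (\<lambda>_. borel) (\<lambda>i \<omega>. step_fun xs (t (Suc i)) * (L (t (Suc i)) \<omega> - L (t i) \<omega>)) {..<n}"
    by (rule indep_vars_compose2[OF indep_increments]) (use pos in auto)
  then have "char (distr M borel (step_integral L xs)) \<theta>
    = (\<Prod>i<n. char (distr M borel (\<lambda>\<omega>. step_fun xs (t (Suc i)) * (L (t (Suc i)) \<omega> - L (t i) \<omega>))) \<theta>)"
    unfolding step_integral_eq_sum_partition[OF t(1) xs, abs_def] by (rule char_distr_sum)
  then show ?thesis
    using pos by (simp add: char_increment_scaled exp_sum sum_negf[symmetric])
qed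

text \<open>The exponent has nonpositive real part because the real part of
  \<open>stable_exponent\<close> is a p-th power, so \<open>exp\<close> is controlled by the modulus
  of the exponent, which is at most a constant times the p-th power integral. This is where the
  \<open>L^p\<close> size of the integrand meets the law of the integral.\<close>

lemma norm_char_step_integral_le:
  assumes xs: "valid_steps xs"
  shows "ennreal (cmod (char (distr M borel (step_integral L xs)) \<theta> - 1))
    \<le> ennreal ((1 + \<bar>tan (pi * p / 2)\<bar>) * \<bar>\<theta>\<bar> powr p)
      * (\<integral>\<^sup>+u. ennreal (\<bar>step_fun xs u\<bar> powr p) \<partial>lborel)"
proof -
  obtain t :: "nat \<Rightarrow> real" and n where t: "mono t" "0 \<le> t 0" and bp: "breakpoints xs \<subseteq> t ` {..n}"
    using finite_subset_range_mono[OF finite_breakpoints breakpoints_nonneg[OF xs]] by blast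
  have le: "t i \<le> t (Suc i)" for i
    using t by (auto simp: mono_def)
  define z where "z = (\<Sum>i<n. of_real (t (Suc i) - t i) * stable_exponent p (step_fun xs (t (Suc i)) * \<theta>))"
  define C where "C = 1 + \<bar>tan (pi * p / 2)\<bar>"
  have "cmod (char (distr M borel (step_integral L xs)) \<theta> - 1) = cmod (exp (- z) - 1)"
    by (simp add: char_step_integral[OF t xs bp] z_def)
  also have "\<dots> \<le> cmod (- z)"
  proof (rule norm_exp_minus_one_le)
    have "0 \<le> Re z"
      unfolding z_def Re_sum using le by (auto intro!: sum_nonneg simp: Re_stable_exponent)
    then show "Re (- z) \<le> 0" by simp
  qed
  also have "\<dots> \<le> (\<Sum>i<n. (t (Suc i) - t i) * (C * \<bar>step_fun xs (t (Suc i)) * \<theta>\<bar> powr p))"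
    unfolding z_def C_def norm_minus_cancel using le
    by (intro sum_norm_le) (auto simp: norm_mult simp del: of_real_diff intro!: mult_left_mono norm_stable_exponent_le)
  also have "\<dots> = C * \<bar>\<theta>\<bar> powr p * (\<Sum>i<n. (t (Suc i) - t i) * \<bar>step_fun xs (t (Suc i))\<bar> powr p)"
    by (simp add: sum_distrib_left abs_mult powr_mult mult_ac)
  finally have "ennreal (cmod (char (distr M borel (step_integral L xs)) \<theta> - 1))
    \<le> ennreal (C * \<bar>\<theta>\<bar> powr p) * ennreal (\<Sum>i<n. (t (Suc i) - t i) * \<bar>step_fun xs (t (Suc i))\<bar> powr p)"
    using le by (subst ennreal_mult[symmetric]) (auto simp: C_def intro!: sum_nonneg ennreal_leI)
  also have "\<dots> \<le> ennreal (C * \<bar>\<theta>\<bar> powr p) * (\<integral>\<^sup>+u. ennreal (\<bar>step_fun xs u\<bar> powr p) \<partial>lborel)"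
    by (intro mult_left_mono sum_partition_le_nn_integral[OF t(1) bp]) simp
  finally show ?thesis
    by (simp add: C_def)
qed

text \<open>The characteristic functions tend to 1, so the laws converge weakly to the point mass at
  0. As 0 is not on the frontier of the set where \<epsilon> is exceeded, the probabilities of that
  set converge to 0.\<close>

lemma step_integral_tendsto_0:
  assumes xs: "\<And>n. valid_steps (xs n)"
    and lim: "(\<lambda>n. \<integral>\<^sup>+u. ennreal (\<bar>step_fun (xs n) u\<bar> powr p) \<partial>lborel) \<longlonglongrightarrow> 0"
  shows "tendsto_in_probability M (\<lambda>n. step_integral L (xs n)) (\<lambda>_. 0)"
proof -
  let ?\<mu> = "\<lambda>n. distr M borel (step_integral L (xs n))"
  note [measurable] = step_integral_measurable[OF xs]
  interpret \<mu>: real_distribution "?\<mu> n" for n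
    by (intro real_distribution_distr) simp
  interpret \<delta>: real_distribution "return borel 0"
    by (auto intro!: prob_space_return simp: real_distribution_def real_distribution_axioms_def)
  have "weak_conv_m ?\<mu> (return borel 0)"
  proof (rule levy_continuity)
    fix \<theta>
    let ?C = "ennreal ((1 + \<bar>tan (pi * p / 2)\<bar>) * \<bar>\<theta>\<bar> powr p)"
    have "(\<lambda>n. ennreal (cmod (char (?\<mu> n) \<theta> - 1))) \<longlonglongrightarrow> ennreal 0"
    proof (rule tendsto_sandwich[where f="\<lambda>_. 0"
          and h="\<lambda>n. ?C * (\<integral>\<^sup>+u. ennreal (\<bar>step_fun (xs n) u\<bar> powr p) \<partial>lborel)"])
      have "(\<lambda>n. ?C * (\<integral>\<^sup>+u. ennreal (\<bar>step_fun (xs n) u\<bar> powr p) \<partial>lborel)) \<longlonglongrightarrow> ?C * 0"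
        by (intro ennreal_tendsto_cmult lim) simp
      then show "(\<lambda>n. ?C * (\<integral>\<^sup>+u. ennreal (\<bar>step_fun (xs n) u\<bar> powr p) \<partial>lborel)) \<longlonglongrightarrow> ennreal 0"
        by simp
    qed (use norm_char_step_integral_le[OF xs] in \<open>auto intro!: always_eventually\<close>)
    then have "(\<lambda>n. cmod (char (?\<mu> n) \<theta> - 1)) \<longlonglongrightarrow> 0"
      by (subst (asm) tendsto_ennreal_iff) auto
    then have "(\<lambda>n. char (?\<mu> n) \<theta>) \<longlonglongrightarrow> 1"
      by (intro LIM_zero_cancel[of _ 1]) (simp only: tendsto_norm_zero_iff)
    then show "(\<lambda>n. char (?\<mu> n) \<theta>) \<longlonglongrightarrow> char (return borel 0) \<theta>"
      by (simp add: char_def integral_return)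
  qed unfold_locales
  then have *: "(\<lambda>n. measure (?\<mu> n) {x. \<epsilon> < \<bar>x\<bar>}) \<longlonglongrightarrow> measure (return borel 0) {x. \<epsilon> < \<bar>x\<bar>}" if "\<epsilon> > 0" for \<epsilon> :: real
  proof (intro weak_conv_imp_continuity_set_conv)
    have "closure {x. \<epsilon> < \<bar>x\<bar>} \<subseteq> {x. \<epsilon> \<le> \<bar>x\<bar>}"
      by (intro closure_minimal closed_Collect_le continuous_intros) auto
    then have "0 \<notin> frontier {x. \<epsilon> < \<bar>x\<bar>}"
      using that by (auto simp: frontier_def)
    then show "emeasure (return borel (0::real)) (frontier {x. \<epsilon> < \<bar>x\<bar>}) = 0"
      by (subst emeasure_return) (simp_all add: borel_closed)
  qed (auto intro: \<mu>.real_distribution_axioms \<delta>.real_distribution_axioms)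
  show ?thesis
    unfolding tendsto_in_probability_def
  proof (intro allI impI)
    fix \<epsilon> :: real assume "\<epsilon> > 0"
    then show "(\<lambda>n. measure M {\<omega> \<in> space M. \<epsilon> < \<bar>step_integral L (xs n) \<omega> - 0\<bar>}) \<longlonglongrightarrow> 0"
      using *[of \<epsilon>] by (simp add: measure_distr measure_return vimage_def Int_def conj_commute)
  qed
qed

end

subsection \<open>Cadlag paths and the kernel\<close>

lemma cadlag_bounded:
  assumes x: "cadlag x"
  shows "\<exists>B. \<forall>s\<in>{0..T}. \<bar>x s\<bar> \<le> B"
proof (cases "0 \<le> T")
  case True
  \<comment> \<open>The bisection principle tests small intervals around every point of
    \<open>[0, T]\<close>, including some that reach below 0, where nothing is known about
    \<open>x\<close>; hence the intersection with \<open>{0..}\<close>.\<close>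
  define P where "P a b = bounded (x ` ({a..b} \<inter> {0..}))" for a b
  have "P 0 T"
  proof (rule Bolzano[OF True])
    fix a b c assume "P a b" "P b c" "a \<le> b" "b \<le> c"
    then have "bounded (x ` ({a..b} \<inter> {0..} \<union> {b..c} \<inter> {0..}))"
      by (simp add: P_def image_Un)
    then show "P a c"
      unfolding P_def by (rule bounded_subset) (intro image_mono, auto)
  next
    fix s assume s: "0 \<le> s" "s \<le> T"
    have "(x \<longlongrightarrow> x s) (at_right s)"
      using x s by (simp add: cadlag_def)
    then have "eventually (\<lambda>u. dist (x u) (x s) < 1) (at_right s)"
      by (rule tendstoD) simp
    then obtain r where r: "r > s" "\<And>u. s < u \<Longrightarrow> u < r \<Longrightarrow> dist (x u) (x s) < 1"
      by (auto simp: eventually_at_right_field)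
    \<comment> \<open>The left limit bounds \<open>x\<close> just before \<open>s\<close>. At
      \<open>s = 0\<close> there is none, but no nonnegative \<open>u\<close> lies below 0 and any
      negative \<open>q\<close> works.\<close>
    have "\<exists>q<s. \<exists>l. \<forall>u\<ge>0. q < u \<longrightarrow> u < s \<longrightarrow> dist (x u) l < 1"
    proof (cases "s = 0")
      case True
      then show ?thesis by (intro exI[of _ "-1"]) auto
    next
      case False
      then obtain l where "(x \<longlongrightarrow> l) (at_left s)"
        using x s unfolding cadlag_def by (metis order_le_less)
      then have "eventually (\<lambda>u. dist (x u) l < 1) (at_left s)"
        by (rule tendstoD) simp
      then show ?thesis
        by (auto simp: eventually_at_left_field)
    qed
    then obtain q l where q: "q < s" "\<And>u. 0 \<le> u \<Longrightarrow> q < u \<Longrightarrow> u < s \<Longrightarrow> dist (x u) l < 1"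
      by blast
    show "\<exists>d>0. \<forall>a b. a \<le> s \<and> s \<le> b \<and> b - a < d \<longrightarrow> P a b"
    proof (intro exI[of _ "min (r - s) (s - q)"] conjI allI impI)
      fix a b assume ab: "a \<le> s \<and> s \<le> b \<and> b - a < min (r - s) (s - q)"
      have "x ` ({a..b} \<inter> {0..}) \<subseteq> ball (x s) 1 \<union> ball l 1"
      proof clarsimp
        fix u assume "a \<le> u" "u \<le> b" "0 \<le> u" "\<not> dist l (x u) < 1"
        then show "dist (x s) (x u) < 1"
          using r(2)[of u] q(2)[of u] ab by (cases u s rule: linorder_cases) (auto simp: dist_commute)
      qed
      then show "P a b"
        unfolding P_def by (rule bounded_subset[rotated]) (simp add: bounded_ball)
    qed (use r q in auto)
  qed
  then show ?thesis
    by (force simp: P_def bounded_iff)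
qed auto

text \<open>For fixed \<open>q\<close> and \<open>a\<close> the set has at most one point: if
  \<open>s < s'\<close> both belong to it, then \<open>s\<close> lies between \<open>a\<close> and
  \<open>s'\<close>, so \<open>x s < q\<close>, against \<open>q < x s\<close>.\<close>

lemma countable_separated_points:
  fixes x :: "real \<Rightarrow> real"
  shows "countable (\<Union>q\<in>\<rat>. \<Union>a\<in>\<rat>. {s. a < s \<and> q < x s \<and> (\<forall>u. a < u \<longrightarrow> u < s \<longrightarrow> x u < q)})"
proof (intro countable_UN countable_rat)
  fix q a
  let ?S = "{s. a < s \<and> q < x s \<and> (\<forall>u. a < u \<longrightarrow> u < s \<longrightarrow> x u < q)}"
  have "s = s'" if "s \<in> ?S" "s' \<in> ?S" for s s'
    using that by (cases s s' rule: linorder_cases) force+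
  then have "\<exists>s. ?S \<subseteq> {s}"
    by blast
  then show "countable ?S"
    using countable_subset by fastforce
qed

text \<open>At a discontinuity the left limit differs from the value. An upward jump is separated by
  a rational level \<open>q\<close> and a rational time \<open>a\<close>, and a downward jump is an
  upward jump of \<open>- x\<close>. At 0, continuity within \<open>{0..}\<close> is
  right-continuity.\<close>

lemma cadlag_countable_discontinuities:
  assumes x: "cadlag x"
  shows "countable {s\<in>{0..}. \<not> continuous (at s within {0..}) x}"
proof -
  define D where "D y = (\<Union>q\<in>\<rat>. \<Union>a\<in>\<rat>. {s. a < s \<and> q < y s \<and> (\<forall>u. a < u \<longrightarrow> u < s \<longrightarrow> y u < q)})"
    for y :: "real \<Rightarrow> real"
  have D: "s \<in> D y" if lim: "(y \<longlongrightarrow> l) (at_left s)" and less: "l < y s" for y l s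
  proof -
    obtain q where q: "q \<in> \<rat>" "l < q" "q < y s"
      using Rats_dense_in_real[OF less] by auto
    have "eventually (\<lambda>u. y u < q) (at_left s)"
      using lim q by (simp add: order_tendstoD)
    then obtain b where b: "b < s" "\<And>u. b < u \<Longrightarrow> u < s \<Longrightarrow> y u < q"
      by (auto simp: eventually_at_left_field)
    obtain a where "a \<in> \<rat>" "b < a" "a < s"
      using Rats_dense_in_real[OF b(1)] by auto
    with b q show ?thesis
      unfolding D_def by (intro UN_I[of q] UN_I[of a]) auto
  qed
  have "{s\<in>{0..}. \<not> continuous (at s within {0..}) x} \<subseteq> D x \<union> D (\<lambda>u. - x u)"
  proof clarsimp
    fix s :: real
    assume s: "0 \<le> s" and disc: "\<not> continuous (at s within {0..}) x" and notin: "s \<notin> D (\<lambda>u. - x u)"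
    have right: "(x \<longlongrightarrow> x s) (at_right s)"
      using x s by (simp add: cadlag_def)
    have "s \<noteq> 0"
    proof
      assume "s = 0"
      moreover have "at (0::real) within {0..} = at_right 0"
        by (rule at_within_Ici_at_right)
      ultimately show False
        using disc right by (simp add: continuous_within)
    qed
    then obtain l where l: "(x \<longlongrightarrow> l) (at_left s)"
      using x s unfolding cadlag_def by (metis order_le_less)
    have "l \<noteq> x s"
    proof
      assume "l = x s"
      then have "isCont x s"
        using l right by (simp add: isCont_def filterlim_split_at)
      then show False
        using disc continuous_at_imp_continuous_at_within by blast
    qed
    moreover have "l \<le> x s"
      using D[OF tendsto_minus[OF l]] notin by force
    ultimately show "s \<in> D x"
      using D[OF l] by simp
  qed
  moreover have "countable (D x \<union> D (\<lambda>u. - x u))"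
    unfolding D_def by (intro countable_Un countable_separated_points)
  ultimately show ?thesis
    by (rule countable_subset)
qed

section \<open>Grid approximation and measurability of cadlag paths\<close>

lemma upper_grid_eqI:
  assumes "of_nat i / of_nat (Suc n) \<le> v" "v < of_nat (Suc i) / of_nat (Suc n)"
  shows "upper_grid n v = of_nat (Suc i) / of_nat (Suc n)"
proof -
  have "of_nat i \<le> v * of_nat (Suc n)" "v * of_nat (Suc n) < of_nat (Suc i)"
    using assms by (simp_all add: divide_le_eq less_divide_eq del: of_nat_Suc)
  then have "\<lfloor>v * of_nat (Suc n)\<rfloor> = of_nat i"
    by (intro floor_unique) auto
  then show ?thesis
    by (simp add: upper_grid_def)
qed

lemma upper_grid_le_1:
  assumes "v < 1"
  shows "upper_grid n v \<le> 1"
proof -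
  have "v * of_nat (Suc n) < of_nat (Suc n)"
    using assms by simp
  then have "\<lfloor>v * of_nat (Suc n)\<rfloor> < of_nat (Suc n)"
    by (simp add: floor_less_iff del: of_nat_Suc)
  then have "\<lfloor>v * of_nat (Suc n)\<rfloor> + 1 \<le> of_nat (Suc n)"
    by linarith
  then have "real_of_int (\<lfloor>v * of_nat (Suc n)\<rfloor> + 1) \<le> of_int (of_nat (Suc n))"
    by (simp only: of_int_le_iff)
  then show ?thesis
    by (simp add: upper_grid_def)
qed

text \<open>Here \<open>x\<close> is arbitrary: \<open>upper_grid\<close> depends on
  \<open>v\<close> only through an integer, and every function of an integer is measurable.\<close>

lemma measurable_compose_upper_grid [measurable]: "(\<lambda>v. x (upper_grid n v)) \<in> borel_measurable borel"
  for x :: "real \<Rightarrow> real"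
  unfolding upper_grid_def by measurable

text \<open>Right-continuity makes the path the pointwise limit of its grid versions. The indicator
  discards negative times, where \<open>cadlag\<close> says nothing.\<close>

lemma cadlag_measurable:
  assumes x: "cadlag x"
  shows "(\<lambda>v. indicat_real {0..} v * x v) \<in> borel_measurable borel"
proof (rule borel_measurable_LIMSEQ_real)
  fix v :: real
  show "(\<lambda>n. indicat_real {0..} v * x (upper_grid n v)) \<longlonglongrightarrow> indicat_real {0..} v * x v"
  proof (cases "0 \<le> v")
    case True
    then show ?thesis
      using x filterlim_compose[OF _ upper_grid_tendsto[of v], of x "nhds (x v)"]
      by (intro tendsto_mult) (auto simp: cadlag_def)
  qed simp
qed measurable

section \<open>The kernel on the unit interval and its derivative\<close>

definition beta_kernel :: "real \<Rightarrow> real \<Rightarrow> real \<Rightarrow> real" where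
  "beta_kernel a b v = v powr a * (1 - v) powr b"

definition beta_kernel_deriv :: "real \<Rightarrow> real \<Rightarrow> real \<Rightarrow> real" where
  "beta_kernel_deriv a b v = a * v powr (a - 1) * (1 - v) powr b - b * v powr a * (1 - v) powr (b - 1)"

lemma beta_kernel_0 [simp]: "beta_kernel a b 0 = 0"
  and beta_kernel_1 [simp]: "beta_kernel a b 1 = 0"
  by (simp_all add: beta_kernel_def)

lemma continuous_on_beta_kernel:
  assumes "0 < a" "0 < b"
  shows "continuous_on {0..1} (beta_kernel a b)"
  unfolding beta_kernel_def
  by (intro continuous_intros continuous_on_powr') (use assms in auto)

lemma DERIV_beta_kernel:
  assumes "0 < v" "v < 1"
  shows "(beta_kernel a b has_real_derivative beta_kernel_deriv a b v) (at v)"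
  unfolding beta_kernel_def beta_kernel_deriv_def
  by (rule derivative_eq_intros refl | use assms in \<open>force simp: algebra_simps powr_diff\<close>)+

lemma isCont_beta_kernel_deriv:
  assumes "0 < v" "v < 1"
  shows "isCont (beta_kernel_deriv a b) v"
  unfolding beta_kernel_deriv_def using assms by (intro continuous_intros) auto

lemma beta_kernel_deriv_measurable [measurable]: "beta_kernel_deriv a b \<in> borel_measurable borel"
  unfolding beta_kernel_deriv_def by measurable

text \<open>The two terms of the derivative are nonnegative up to sign and dominated by
  \<open>a * v powr (a - 1)\<close> and \<open>b * (1 - v) powr (b - 1)\<close>. Each majorant may
  be singular at one end, yet is the derivative of a bounded monotone function, so the fundamental
  theorem for nonnegative integrands makes it integrable.\<close>

lemma set_integrable_beta_kernel_deriv: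
  assumes a: "0 < a" and b: "0 < b"
  shows "set_integrable lborel {0<..<1} (beta_kernel_deriv a b)"
proof (rule set_integrable_bound)
  have "set_integrable lborel (einterval 0 1) (\<lambda>v. a * v powr (a - 1))"
  proof (rule interval_integral_FTC_nonneg(1))
    show "DERIV (\<lambda>v. v powr a) v :> a * v powr (a - 1)" if "0 < ereal v" for v
      using that by (auto intro!: derivative_eq_intros)
    show "isCont (\<lambda>v. a * v powr (a - 1)) v" if "0 < ereal v" for v
      using that by (intro continuous_intros) auto
    show "(((\<lambda>v. v powr a) \<circ> real_of_ereal) \<longlongrightarrow> 0) (at_right 0)"
      unfolding zero_ereal_def ereal_tendsto_simps using a
      by (auto intro!: tendsto_eq_intros tendsto_powr' simp: eventually_at_right_field)
    show "(((\<lambda>v. v powr a) \<circ> real_of_ereal) \<longlongrightarrow> 1) (at_left 1)"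
      unfolding one_ereal_def ereal_tendsto_simps using a
      by (auto intro!: tendsto_eq_intros tendsto_powr')
  qed (use a in auto)
  moreover have "set_integrable lborel (einterval 0 1) (\<lambda>v. b * (1 - v) powr (b - 1))"
  proof (rule interval_integral_FTC_nonneg(1))
    show "DERIV (\<lambda>v. - ((1 - v) powr b)) v :> b * (1 - v) powr (b - 1)" if "ereal v < 1" for v
      using that by (auto intro!: derivative_eq_intros)
    show "isCont (\<lambda>v. b * (1 - v) powr (b - 1)) v" if "ereal v < 1" for v
      using that by (intro continuous_intros) auto
    show "(((\<lambda>v. - ((1 - v) powr b)) \<circ> real_of_ereal) \<longlongrightarrow> - 1) (at_right 0)"
      unfolding zero_ereal_def ereal_tendsto_simps using b
      by (auto intro!: tendsto_eq_intros tendsto_powr')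
    show "(((\<lambda>v. - ((1 - v) powr b)) \<circ> real_of_ereal) \<longlongrightarrow> 0) (at_left 1)"
      unfolding one_ereal_def ereal_tendsto_simps using b
      by (auto intro!: tendsto_eq_intros tendsto_powr' simp: eventually_at_left_field lt_ex)
  qed (use b in auto)
  ultimately show "set_integrable lborel {0<..<1} (\<lambda>v. a * v powr (a - 1) + b * (1 - v) powr (b - 1))"
    by (simp add: zero_ereal_def one_ereal_def set_integral_add)
  show "set_borel_measurable lborel {0<..<1} (beta_kernel_deriv a b)"
    unfolding set_borel_measurable_def by measurable
  show "AE v in lborel. v \<in> {0<..<1} \<longrightarrow> norm (beta_kernel_deriv a b v)
      \<le> norm (a * v powr (a - 1) + b * (1 - v) powr (b - 1))"
  proof (intro AE_I2 impI)
    fix v :: real assume v: "v \<in> {0<..<1}"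
    have "a * v powr (a - 1) * (1 - v) powr b \<le> a * v powr (a - 1) * 1"
      using v a b by (intro mult_left_mono) (auto simp: powr_le1)
    moreover have "b * (1 - v) powr (b - 1) * v powr a \<le> b * (1 - v) powr (b - 1) * 1"
      using v a b by (intro mult_left_mono) (auto simp: powr_le1)
    moreover have "0 \<le> a * v powr (a - 1) * (1 - v) powr b" "0 \<le> b * v powr a * (1 - v) powr (b - 1)"
      using a b by auto
    ultimately show "norm (beta_kernel_deriv a b v) \<le> norm (a * v powr (a - 1) + b * (1 - v) powr (b - 1))"
      unfolding beta_kernel_deriv_def real_norm_def by (simp add: mult_ac abs_le_iff)
  qed
qed

text \<open>The fundamental theorem is used in the form that asks for a derivative only in the open
  interval and for limits of the primitive at its ends. This covers the cells that touch 0 or 1,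
  where the derivative may blow up.\<close>

lemma integral_beta_kernel_deriv:
  assumes a: "0 < a" and b: "0 < b" and xy: "0 \<le> x" "x < y" "y \<le> 1"
  shows "(LBINT v:{x..<y}. beta_kernel_deriv a b v) = beta_kernel a b y - beta_kernel a b x"
proof -
  have "(LBINT v=ereal x..ereal y. beta_kernel_deriv a b v) = beta_kernel a b y - beta_kernel a b x"
  proof (rule interval_integral_FTC_integrable)
    show "(beta_kernel a b has_vector_derivative beta_kernel_deriv a b v) (at v)"
      if "ereal x < ereal v" "ereal v < ereal y" for v
      using DERIV_beta_kernel[of v a b] that xy
      by (simp add: has_real_derivative_iff_has_vector_derivative)
    show "isCont (beta_kernel_deriv a b) v" if "ereal x < ereal v" "ereal v < ereal y" for v
      using that xy by (intro isCont_beta_kernel_deriv) auto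
    show "set_integrable lborel (einterval (ereal x) (ereal y)) (beta_kernel_deriv a b)"
      by (rule set_integrable_subset[OF set_integrable_beta_kernel_deriv[OF a b]]) (use xy in auto)
    have c: "continuous_on {x..y} (beta_kernel a b)"
      using continuous_on_subset[OF continuous_on_beta_kernel[OF a b], of "{x..y}"] xy by auto
    show "((beta_kernel a b \<circ> real_of_ereal) \<longlongrightarrow> beta_kernel a b x) (at_right (ereal x))"
      using c xy unfolding ereal_tendsto_simps
      by (simp add: continuous_on_def) (metis at_within_Icc_at_right atLeastAtMost_iff order_refl less_imp_le)
    show "((beta_kernel a b \<circ> real_of_ereal) \<longlongrightarrow> beta_kernel a b y) (at_left (ereal y))"
      using c xy unfolding ereal_tendsto_simps
      by (simp add: continuous_on_def) (metis at_within_Icc_at_left atLeastAtMost_iff order_refl less_imp_le)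
  qed (use xy in auto)
  then show ?thesis
    using xy by (simp add: interval_integral_Ico)
qed

subsection \<open>The pathwise integral\<close>

text \<open>The kernel is evaluated at the left end of each cell, so that summation by parts leaves
  \<open>x\<close> at the right end.\<close>

definition beta_riemann_sum :: "real \<Rightarrow> real \<Rightarrow> (real \<Rightarrow> real) \<Rightarrow> nat \<Rightarrow> real" where
  "beta_riemann_sum a b x n = (\<Sum>i<Suc n. beta_kernel a b (of_nat i / of_nat (Suc n)) *
     (x (of_nat (Suc i) / of_nat (Suc n)) - x (of_nat i / of_nat (Suc n))))"

text \<open>Summation by parts; the boundary terms vanish because the kernel is zero at both ends.\<close>

lemma beta_riemann_sum_eq_integral:
  assumes ab: "0 < a" "0 < b"
  shows "beta_riemann_sum a b x n = - (LBINT v:{0<..<1}. beta_kernel_deriv a b v * x (upper_grid n v))"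
proof -
  define s :: "nat \<Rightarrow> real" where "s i = of_nat i / of_nat (Suc n)" for i
  define k where "k = beta_kernel_deriv a b"
  define f where "f v = k v * x (upper_grid n v)" for v
  have s: "0 \<le> s i" "s i < s (Suc i)" "s 0 = 0" "s (Suc n) = 1" for i
    by (simp_all add: s_def divide_strict_right_mono)
  have s_le: "i \<le> n \<Longrightarrow> s (Suc i) \<le> 1" for i
    by (simp add: s_def)
  have grid: "upper_grid n v = s (Suc i)" if "v \<in> {s i..<s (Suc i)}" for v i
    using that unfolding s_def by (intro upper_grid_eqI) auto
  have int_k: "set_integrable lborel {s i..<s (Suc i)} k" if "i < Suc n" for i
  proof -
    have "set_integrable lborel {0..<1} k"
      using set_integrable_beta_kernel_deriv[OF ab] unfolding k_def set_integrable_def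
      by (rule integrable_cong_AE_imp) (use AE_lborel_singleton[of 0] in \<open>auto simp: indicator_def\<close>)
    then show ?thesis
      by (rule set_integrable_subset) (use s s_le[of i] that in \<open>auto simp: order.trans[of 0]\<close>)
  qed
  have piece: "(LBINT v:{s i..<s (Suc i)}. f v) = (beta_kernel a b (s (Suc i)) - beta_kernel a b (s i)) * x (s (Suc i))"
    if "i < Suc n" for i
  proof -
    have "(LBINT v:{s i..<s (Suc i)}. f v) = (LBINT v:{s i..<s (Suc i)}. k v * x (s (Suc i)))"
      by (rule set_lebesgue_integral_cong) (auto simp: f_def grid)
    also have "\<dots> = (LBINT v:{s i..<s (Suc i)}. k v) * x (s (Suc i))"
      by simp
    finally show ?thesis
      using integral_beta_kernel_deriv[OF ab, of "s i" "s (Suc i)"] s s_le[of i] that by (simp add: k_def)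
  qed
  have union: "(\<Union>i<m. {s i..<s (Suc i)}) = {0..<s m}" for m
  proof (induction m)
    case (Suc m)
    then show ?case
      using s(1,2)[of m] by (auto simp: lessThan_Suc)
  qed (simp add: s)
  \<comment> \<open>Adding the null point 0 lets the half-open cells on which
    \<open>upper_grid n\<close> is constant tile the domain exactly.\<close>
  have "(LBINT v:{0<..<1}. f v) = (LBINT v:{0..<1}. f v)"
    unfolding set_lebesgue_integral_def
    by (rule integral_cong_AE) (use AE_lborel_singleton[of 0] in \<open>auto simp: indicator_def f_def k_def\<close>)
  also have "\<dots> = (LBINT v:(\<Union>i<Suc n. {s i..<s (Suc i)}). f v)"
    by (simp add: union s)
  also have "\<dots> = (\<Sum>i<Suc n. (LBINT v:{s i..<s (Suc i)}. f v))"
  proof (rule set_integral_finite_Union)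
    show "disjoint_family_on (\<lambda>i. {s i..<s (Suc i)}) {..<Suc n}"
      unfolding disjoint_family_on_def
    proof (intro ballI impI)
      have *: "{s i..<s (Suc i)} \<inter> {s j..<s (Suc j)} = {}" if "i < j" for i j
      proof -
        have "s (Suc i) \<le> s j"
          using that unfolding s_def by (intro divide_right_mono) auto
        then show ?thesis by auto
      qed
      show "{s i..<s (Suc i)} \<inter> {s j..<s (Suc j)} = {}" if "i \<noteq> j" for i j
        using *[of i j] *[of j i] that by (cases i j rule: linorder_cases) auto
    qed
    show "set_integrable lborel {s i..<s (Suc i)} f" if "i \<in> {..<Suc n}" for i
    proof -
      have "set_integrable lborel {s i..<s (Suc i)} (\<lambda>v. k v * x (s (Suc i)))"
        using int_k that by simp
      then show ?thesis
        by (rule set_integrable_cong[THEN iffD1, rotated -1]) (auto simp: f_def grid)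
    qed
  qed auto
  also have "\<dots> = (\<Sum>i<Suc n. (beta_kernel a b (s (Suc i)) - beta_kernel a b (s i)) * x (s (Suc i)))"
    by (intro sum.cong) (auto simp: piece)
  finally have int: "(LBINT v:{0<..<1}. f v)
    = (\<Sum>i<Suc n. (beta_kernel a b (s (Suc i)) - beta_kernel a b (s i)) * x (s (Suc i)))" .
  have "(LBINT v:{0<..<1}. f v) + beta_riemann_sum a b x n =
    (\<Sum>i<Suc n. beta_kernel a b (s (Suc i)) * x (s (Suc i)) - beta_kernel a b (s i) * x (s i))"
    unfolding int beta_riemann_sum_def s_def[symmetric] sum.distrib[symmetric]
    by (intro sum.cong) (auto simp: algebra_simps)
  also have "\<dots> = 0"
    by (subst sum_lessThan_telescope) (simp add: s)
  finally show ?thesis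
    by (simp add: f_def k_def)
qed

text \<open>The domain is fixed and \<open>t\<close> enters only through the path. The factor
  \<open>t powr (a + b)\<close> is left out and restored when this is compared with step
  integrals.\<close>

definition pathwise_beta_integral :: "real \<Rightarrow> real \<Rightarrow> (real \<Rightarrow> real) \<Rightarrow> real \<Rightarrow> real" where
  "pathwise_beta_integral a b x t = - (LBINT v:{0<..<1}. beta_kernel_deriv a b v * x (t * v))"

lemma cadlag_scaled_measurable:
  assumes x: "cadlag x" and t: "0 \<le> t"
  shows "(\<lambda>v. indicat_real {0<..<1} v * x (t * v)) \<in> borel_measurable lborel"
proof -
  have "(\<lambda>v. indicat_real {0..} (t * v) * x (t * v)) \<in> borel_measurable lborel"
    by (rule measurable_compose[OF _ cadlag_measurable[OF x]]) simp
  then have "(\<lambda>v. indicat_real {0<..<1} v * (indicat_real {0..} (t * v) * x (t * v))) \<in> borel_measurable lborel"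
    by (rule borel_measurable_times[rotated]) simp
  also have "(\<lambda>v. indicat_real {0<..<1} v * (indicat_real {0..} (t * v) * x (t * v)))
    = (\<lambda>v. indicat_real {0<..<1} v * x (t * v))"
    using t by (auto simp: fun_eq_iff indicator_def)
  finally show ?thesis .
qed

text \<open>Dominated convergence with majorant \<open>B\<close> times the modulus of the kernel
  derivative. It serves both limits: refinement of the grid and variation of the time.\<close>

lemma beta_integral_tendsto:
  assumes ab: "0 < a" "0 < b" 
    and f: "(\<lambda>v. indicat_real {0<..<1} v * f v) \<in> borel_measurable lborel"
    and fn: "\<And>n. (\<lambda>v. indicat_real {0<..<1} v * fn n v) \<in> borel_measurable lborel"
    and B: "\<And>n v. 0 < v \<Longrightarrow> v < 1 \<Longrightarrow> \<bar>fn n v\<bar> \<le> B"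
    and lim: "AE v in lborel. 0 < v \<longrightarrow> v < 1 \<longrightarrow> (\<lambda>n. fn n v) \<longlonglongrightarrow> f v"
  shows "(\<lambda>n. LBINT v:{0<..<1}. beta_kernel_deriv a b v * fn n v)
    \<longlonglongrightarrow> (LBINT v:{0<..<1}. beta_kernel_deriv a b v * f v)"
  unfolding set_lebesgue_integral_def
proof (rule integral_dominated_convergence)
  note [measurable] = f fn
  show "integrable lborel (\<lambda>v. \<bar>indicat_real {0<..<1} v *\<^sub>R beta_kernel_deriv a b v\<bar> * B)"
    using set_integrable_beta_kernel_deriv[OF ab] unfolding set_integrable_def by simp
  have eq: "indicat_real {0<..<1} v *\<^sub>R (beta_kernel_deriv a b v * y) =
      beta_kernel_deriv a b v * (indicat_real {0<..<1} v * y)" for v y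
    by simp
  show "(\<lambda>v. indicat_real {0<..<1} v *\<^sub>R (beta_kernel_deriv a b v * fn n v)) \<in> borel_measurable lborel"
    "(\<lambda>v. indicat_real {0<..<1} v *\<^sub>R (beta_kernel_deriv a b v * f v)) \<in> borel_measurable lborel" for n
    unfolding eq by measurable
  show "AE v in lborel. (\<lambda>n. indicat_real {0<..<1} v *\<^sub>R (beta_kernel_deriv a b v * fn n v))
    \<longlonglongrightarrow> indicat_real {0<..<1} v *\<^sub>R (beta_kernel_deriv a b v * f v)"
    using lim by eventually_elim (auto split: split_indicator intro!: tendsto_intros)
  show "AE v in lborel. norm (indicat_real {0<..<1} v *\<^sub>R (beta_kernel_deriv a b v * fn n v))
    \<le> \<bar>indicat_real {0<..<1} v *\<^sub>R beta_kernel_deriv a b v\<bar> * B" for n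
    using B[of _ n] by (intro AE_I2) (auto simp: indicator_def abs_mult intro!: mult_left_mono)
qed


lemma cadlag_scaled_bounded:
  assumes x: "cadlag x" and "0 \<le> T"
  obtains B where "\<And>t v. 0 \<le> t \<Longrightarrow> t \<le> T \<Longrightarrow> 0 \<le> v \<Longrightarrow> v \<le> 1 \<Longrightarrow> \<bar>x (t * v)\<bar> \<le> B"
proof -
  obtain B where B: "\<forall>s\<in>{0..T}. \<bar>x s\<bar> \<le> B"
    using cadlag_bounded[OF x] by blast
  have "\<bar>x (t * v)\<bar> \<le> B" if "0 \<le> t" "t \<le> T" "0 \<le> v" "v \<le> 1" for t v
    using B mult_mono[of t T v 1] that by auto
  then show ?thesis
    by (rule that)
qed

lemma beta_riemann_sum_tendsto:
  assumes ab: "0 < a" "0 < b" and x: "cadlag x" and t: "0 \<le> t"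
  shows "beta_riemann_sum a b (\<lambda>v. x (t * v)) \<longlonglongrightarrow> pathwise_beta_integral a b x t"
proof -
  obtain B where B: "\<And>s v. 0 \<le> s \<Longrightarrow> s \<le> t \<Longrightarrow> 0 \<le> v \<Longrightarrow> v \<le> 1 \<Longrightarrow> \<bar>x (s * v)\<bar> \<le> B"
    using cadlag_scaled_bounded[OF x t] by blast
  have "(\<lambda>n. LBINT v:{0<..<1}. beta_kernel_deriv a b v * x (t * upper_grid n v))
    \<longlonglongrightarrow> (LBINT v:{0<..<1}. beta_kernel_deriv a b v * x (t * v))"
  proof (rule beta_integral_tendsto[OF ab])
    show "(\<lambda>v. indicat_real {0<..<1} v * x (t * v)) \<in> borel_measurable lborel"
      by (rule cadlag_scaled_measurable[OF x t])
    show "(\<lambda>v. indicat_real {0<..<1} v * x (t * upper_grid n v)) \<in> borel_measurable lborel" for n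
      using measurable_compose_upper_grid[of "\<lambda>u. x (t * u)" n] by simp
    show "\<bar>x (t * upper_grid n v)\<bar> \<le> B" if "0 < v" "v < 1" for n v
      using B[of t "upper_grid n v"] t upper_grid_gt[of v n] upper_grid_le_1[of v n] that by simp
    show "AE v in lborel. 0 < v \<longrightarrow> v < 1 \<longrightarrow> (\<lambda>n. x (t * upper_grid n v)) \<longlonglongrightarrow> x (t * v)"
    proof (intro AE_I2 impI)
      fix v :: real assume v: "0 < v"
      show "(\<lambda>n. x (t * upper_grid n v)) \<longlonglongrightarrow> x (t * v)"
      \<comment> \<open>\<open>at_right\<close> excludes the limit point, so \<open>t = 0\<close>,
        where the argument does not move, is treated apart.\<close>
      proof (cases "t = 0")
        case False
        have "filterlim (\<lambda>n. t * upper_grid n v) (at_right (t * v)) sequentially"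
          using upper_grid_tendsto[of v] upper_grid_gt[of v] False t
          by (auto simp: filterlim_at order_less_imp_not_eq2 intro!: tendsto_intros)
        then show ?thesis
          using x t v filterlim_compose[of x "nhds (x (t * v))" "at_right (t * v)"]
          by (auto simp: cadlag_def)
      qed simp
    qed
  qed
  then show ?thesis
    unfolding pathwise_beta_integral_def beta_riemann_sum_eq_integral[OF ab, abs_def] by (rule tendsto_minus)
qed

text \<open>For fixed \<open>t\<close>, the points \<open>v\<close> at which \<open>t * v\<close>
  hits a jump of the path can be confined to a countable, hence null, set; at every other
  \<open>v\<close> the integrand converges.\<close>

lemma continuous_on_pathwise_beta_integral:
  assumes ab: "0 < a" "0 < b" and x: "cadlag x"
  shows "continuous_on {0..} (pathwise_beta_integral a b x)"
proof (rule continuous_on_sequentiallyI)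
  fix u :: "nat \<Rightarrow> real" and t
  assume u: "\<forall>n. u n \<in> {0..}" and t: "t \<in> {0..}" and lim: "u \<longlonglongrightarrow> t"
  obtain T where "\<forall>n. \<bar>u n\<bar> \<le> T"
    using convergent_imp_Bseq[of u] lim by (auto simp: Bseq_def convergent_def)
  then have T: "u n \<le> T" for n
    by (meson abs_le_D1)
  then have "0 \<le> T"
    using u order.trans[of 0 "u 0" T] by auto
  then obtain B where B: "\<And>s v. 0 \<le> s \<Longrightarrow> s \<le> T \<Longrightarrow> 0 \<le> v \<Longrightarrow> v \<le> 1 \<Longrightarrow> \<bar>x (s * v)\<bar> \<le> B"
    using cadlag_scaled_bounded[OF x] by blast
  let ?D = "{s\<in>{0..}. \<not> continuous (at s within {0..}) x}"
  \<comment> \<open>Right-continuity is continuity at the boundary point 0. So \<open>t * v\<close>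
    in this set forces \<open>t\<close> to be nonzero and \<open>v = t * v / t\<close> to lie in the
    image removed below; for \<open>t = 0\<close> that image is harmless.\<close>
  have cont0: "0 \<notin> ?D"
    using x by (auto simp: cadlag_def continuous_within at_within_Ici_at_right)
  have "(\<lambda>n. LBINT v:{0<..<1}. beta_kernel_deriv a b v * x (u n * v))
    \<longlonglongrightarrow> (LBINT v:{0<..<1}. beta_kernel_deriv a b v * x (t * v))"
  proof (rule beta_integral_tendsto[OF ab])
    show "(\<lambda>v. indicat_real {0<..<1} v * x (t * v)) \<in> borel_measurable lborel"
      "(\<lambda>v. indicat_real {0<..<1} v * x (u n * v)) \<in> borel_measurable lborel" for n
      by (rule cadlag_scaled_measurable[OF x]; use u t in simp)+
    show "\<bar>x (u n * v)\<bar> \<le> B" if "0 < v" "v < 1" for n v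
      using B[of "u n" v] u T that by simp
    show "AE v in lborel. 0 < v \<longrightarrow> v < 1 \<longrightarrow> (\<lambda>n. x (u n * v)) \<longlonglongrightarrow> x (t * v)"
    proof (rule AE_mp[OF AE_not_in AE_I2])
      show "(\<lambda>s. s / t) ` ?D \<in> null_sets lborel"
        by (intro countable_imp_null_set_lborel countable_image cadlag_countable_discontinuities[OF x])
      fix v
      show "v \<notin> (\<lambda>s. s / t) ` ?D \<longrightarrow> 0 < v \<longrightarrow> v < 1 \<longrightarrow> (\<lambda>n. x (u n * v)) \<longlonglongrightarrow> x (t * v)"
      proof (intro impI)
        assume v: "v \<notin> (\<lambda>s. s / t) ` ?D" "0 < v"
        have "t * v \<notin> ?D"
        proof
          assume D: "t * v \<in> ?D"
          then have "t \<noteq> 0"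
            using cont0 by (metis mult_zero_left)
          then have "v = t * v / t"
            by simp
          with D v(1) show False
            by blast
        qed
        then have "continuous (at (t * v) within {0..}) x"
          using t v by simp
        moreover have "(\<lambda>n. u n * v) \<longlonglongrightarrow> t * v"
          by (intro tendsto_intros lim)
        ultimately show "(\<lambda>n. x (u n * v)) \<longlonglongrightarrow> x (t * v)"
          using u v by (auto intro!: continuous_within_tendsto_compose'[of "t * v" "{0..}" x])
      qed
    qed
  qed
  then show "(\<lambda>n. pathwise_beta_integral a b x (u n)) \<longlonglongrightarrow> pathwise_beta_integral a b x t"
    unfolding pathwise_beta_integral_def by (rule tendsto_minus)
qed

subsection \<open>Uniqueness of the stable integral\<close>

lemma step_fun_measurable [measurable]: "step_fun xs \<in> borel_measurable borel"
proof (induction xs)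
  case Nil
  then show ?case by (simp add: step_fun_def[abs_def])
next
  case (Cons x xs)
  obtain c a b where x: "x = (c, a, b)" by (cases x)
  have "step_fun (x # xs) = (\<lambda>u. c * indicat_real {a<..b} u + step_fun xs u)"
    by (simp add: x step_fun_def fun_eq_iff)
  with Cons show ?case by simp
qed

text \<open>Since overlaps are allowed, subtraction of step functions is concatenation with negated
  coefficients, without any refinement.\<close>

definition negate_steps :: "(real \<times> real \<times> real) list \<Rightarrow> (real \<times> real \<times> real) list" where
  "negate_steps = map (\<lambda>(c, a, b). (- c, a, b))"

lemma valid_steps_append_negate:
  "valid_steps xs \<Longrightarrow> valid_steps ys \<Longrightarrow> valid_steps (xs @ negate_steps ys)"
  by (force simp: valid_steps_def negate_steps_def)

lemma step_fun_append_negate: "step_fun (xs @ negate_steps ys) u = step_fun xs u - step_fun ys u"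
proof -
  have "step_fun (negate_steps ys) u = - step_fun ys u"
    by (induction ys) (auto simp: step_fun_def negate_steps_def)
  then show ?thesis
    by (simp add: step_fun_def)
qed

lemma step_integral_append_negate:
  "step_integral L (xs @ negate_steps ys) \<omega> = step_integral L xs \<omega> - step_integral L ys \<omega>"
proof -
  have "step_integral L (negate_steps ys) \<omega> = - step_integral L ys \<omega>"
    by (induction ys) (auto simp: step_integral_def negate_steps_def algebra_simps)
  then show ?thesis
    by (simp add: step_integral_def)
qed

text \<open>Takes the place of the triangle inequality in \<open>L^p\<close>: the difference is at
  most twice the larger modulus. The crude constant is harmless, since the right side will tend to
  0.\<close>

lemma abs_diff_powr_le:
  fixes x y :: real
  assumes "0 < p"
  shows "\<bar>x - y\<bar> powr p \<le> 2 powr p * (\<bar>x\<bar> powr p + \<bar>y\<bar> powr p)"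
proof -
  have "\<bar>x - y\<bar> powr p \<le> (2 * max \<bar>x\<bar> \<bar>y\<bar>) powr p"
    using assms by (intro powr_mono2) auto
  also have "\<dots> = 2 powr p * max \<bar>x\<bar> \<bar>y\<bar> powr p"
    by (simp add: powr_mult)
  also have "\<dots> \<le> 2 powr p * (\<bar>x\<bar> powr p + \<bar>y\<bar> powr p)"
    by (intro mult_left_mono) (auto simp: max_def)
  finally show ?thesis .
qed

text \<open>If \<open>Y\<close> and \<open>Z\<close> differ by more than \<epsilon>, one of the
  three links from \<open>Y\<close> through \<open>X n\<close> and \<open>X' n\<close> to
  \<open>Z\<close> exceeds \<epsilon>/3, and each of these probabilities tends to 0.\<close>

lemma (in prob_space) AE_eq_if_tendsto_in_probability:
  assumes X: "\<And>n. random_variable borel (X n)" and X': "\<And>n. random_variable borel (X' n)"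
    and Y: "random_variable borel Y" and Z: "random_variable borel Z"
    and XY: "tendsto_in_probability M X Y" and XZ: "tendsto_in_probability M X' Z"
    and diff: "tendsto_in_probability M (\<lambda>n \<omega>. X n \<omega> - X' n \<omega>) (\<lambda>_. 0)"
  shows "AE \<omega> in M. Y \<omega> = Z \<omega>"
proof -
  note [measurable] = X X' Y Z
  have null: "prob {\<omega> \<in> space M. \<epsilon> < \<bar>Y \<omega> - Z \<omega>\<bar>} = 0" if "0 < \<epsilon>" for \<epsilon>
  proof -
    define A where "A n = {\<omega> \<in> space M. \<epsilon> / 3 < \<bar>X n \<omega> - Y \<omega>\<bar>}" for n
    define B where "B n = {\<omega> \<in> space M. \<epsilon> / 3 < \<bar>X' n \<omega> - Z \<omega>\<bar>}" for n
    define C where "C n = {\<omega> \<in> space M. \<epsilon> / 3 < \<bar>X n \<omega> - X' n \<omega> - 0\<bar>}" for n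
    have [measurable]: "A n \<in> events" "B n \<in> events" "C n \<in> events" for n
      unfolding A_def B_def C_def by measurable
    have "prob {\<omega> \<in> space M. \<epsilon> < \<bar>Y \<omega> - Z \<omega>\<bar>} \<le> prob (A n) + prob (B n) + prob (C n)" for n
    proof -
      have "prob {\<omega> \<in> space M. \<epsilon> < \<bar>Y \<omega> - Z \<omega>\<bar>} \<le> prob ((A n \<union> B n) \<union> C n)"
      proof (rule finite_measure_mono)
        show "{\<omega> \<in> space M. \<epsilon> < \<bar>Y \<omega> - Z \<omega>\<bar>} \<subseteq> A n \<union> B n \<union> C n"
        proof
          fix \<omega> assume "\<omega> \<in> {\<omega> \<in> space M. \<epsilon> < \<bar>Y \<omega> - Z \<omega>\<bar>}"
          moreover have "\<bar>Y \<omega> - Z \<omega>\<bar> \<le> \<bar>X n \<omega> - Y \<omega>\<bar> + \<bar>X' n \<omega> - Z \<omega>\<bar> + \<bar>X n \<omega> - X' n \<omega> - 0\<bar>"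
            by linarith
          ultimately show "\<omega> \<in> A n \<union> B n \<union> C n"
            unfolding A_def B_def C_def by auto
        qed
      qed measurable
      also have "\<dots> \<le> prob (A n \<union> B n) + prob (C n)"
        by (rule measure_Un_le) measurable
      also have "prob (A n \<union> B n) \<le> prob (A n) + prob (B n)"
        by (rule measure_Un_le) measurable
      finally show ?thesis by simp
    qed
    moreover have "(\<lambda>n. prob (A n) + prob (B n) + prob (C n)) \<longlonglongrightarrow> 0 + 0 + 0"
      unfolding A_def B_def C_def
      by (intro tendsto_add XY[unfolded tendsto_in_probability_def, rule_format]
          XZ[unfolded tendsto_in_probability_def, rule_format]
          diff[unfolded tendsto_in_probability_def, rule_format]) (use \<open>0 < \<epsilon>\<close> in simp_all)
    ultimately have "prob {\<omega> \<in> space M. \<epsilon> < \<bar>Y \<omega> - Z \<omega>\<bar>} \<le> 0 + 0 + 0"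
      by (intro LIMSEQ_le_const) auto
    then show ?thesis
      by (simp add: measure_le_0_iff)
  qed
  have "AE \<omega> in M. \<forall>n. \<bar>Y \<omega> - Z \<omega>\<bar> \<le> inverse (of_nat (Suc n))"
  proof (subst AE_all_countable, intro allI)
    fix n
    show "AE \<omega> in M. \<bar>Y \<omega> - Z \<omega>\<bar> \<le> inverse (of_nat (Suc n))"
      using null[of "inverse (of_nat (Suc n))"]
      by (intro AE_I[of _ _ "{\<omega> \<in> space M. inverse (of_nat (Suc n)) < \<bar>Y \<omega> - Z \<omega>\<bar>}"])
         (auto simp: emeasure_eq_measure not_le)
  qed
  then show ?thesis
  proof eventually_elim
    case (elim \<omega>)
    have "\<bar>Y \<omega> - Z \<omega>\<bar> \<le> 0"
      by (rule LIMSEQ_le_const[OF LIMSEQ_inverse_real_of_nat]) (use elim in auto)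
    then show ?case by simp
  qed
qed

lemma (in prob_space) tendsto_in_probability_if_AE:
  assumes [measurable]: "\<And>n. random_variable borel (X n)" "random_variable borel Y"
    and lim: "AE \<omega> in M. (\<lambda>n. X n \<omega>) \<longlonglongrightarrow> Y \<omega>"
  shows "tendsto_in_probability M X Y"
  unfolding tendsto_in_probability_def
proof (intro allI impI)
  fix \<epsilon> :: real assume \<epsilon>: "0 < \<epsilon>"
  have "(\<lambda>n. \<integral>\<omega>. indicat_real {\<omega> \<in> space M. \<epsilon> < \<bar>X n \<omega> - Y \<omega>\<bar>} \<omega> \<partial>M) \<longlonglongrightarrow> (\<integral>\<omega>. 0 \<partial>M)"
  proof (rule integral_dominated_convergence[where w="\<lambda>_. 1"])
    show "AE \<omega> in M. (\<lambda>n. indicat_real {\<omega> \<in> space M. \<epsilon> < \<bar>X n \<omega> - Y \<omega>\<bar>} \<omega>) \<longlonglongrightarrow> 0"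
      using lim
    proof eventually_elim
      case (elim \<omega>)
      have "eventually (\<lambda>n. dist (X n \<omega>) (Y \<omega>) < \<epsilon>) sequentially"
        using elim \<epsilon> by (rule tendstoD)
      then have "eventually (\<lambda>n. indicat_real {\<omega> \<in> space M. \<epsilon> < \<bar>X n \<omega> - Y \<omega>\<bar>} \<omega> = 0) sequentially"
        by eventually_elim (auto simp: dist_real_def)
      then show ?case
        by (rule tendsto_eventually)
    qed
  qed auto
  then show "(\<lambda>n. prob {\<omega> \<in> space M. \<epsilon> < \<bar>X n \<omega> - Y \<omega>\<bar>}) \<longlonglongrightarrow> 0"
    by simp
qed

text \<open>The difference of two approximating sequences is again a sequence of step functions, now
  tending to 0 in \<open>L^p\<close>, so its integrals tend to 0 in probability.\<close>

lemma (in right_skewed_stable_levy_process) has_stable_integral_unique: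
  assumes Y: "has_stable_integral M p L A g Y" and Z: "has_stable_integral M p L A g Z"
  shows "AE \<omega> in M. Y \<omega> = Z \<omega>"
proof -
  define f where "f u = indicat_real A u * g u" for u
  have [measurable]: "f \<in> borel_measurable borel"
    using Y by (simp add: has_stable_integral_def set_borel_measurable_def f_def[abs_def])
  obtain xs where xs: "\<And>n. valid_steps (xs n)"
      "(\<lambda>n. \<integral>\<^sup>+u. ennreal (\<bar>f u - step_fun (xs n) u\<bar> powr p) \<partial>lborel) \<longlonglongrightarrow> 0"
      "tendsto_in_probability M (\<lambda>n. step_integral L (xs n)) Y"
    using Y by (auto simp: has_stable_integral_def f_def)
  obtain ys where ys: "\<And>n. valid_steps (ys n)"
      "(\<lambda>n. \<integral>\<^sup>+u. ennreal (\<bar>f u - step_fun (ys n) u\<bar> powr p) \<partial>lborel) \<longlonglongrightarrow> 0"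
      "tendsto_in_probability M (\<lambda>n. step_integral L (ys n)) Z"
    using Z by (auto simp: has_stable_integral_def f_def)
  define zs where "zs n = xs n @ negate_steps (ys n)" for n
  have "(\<lambda>n. \<integral>\<^sup>+u. ennreal (\<bar>step_fun (zs n) u\<bar> powr p) \<partial>lborel) \<longlonglongrightarrow> 0"
  proof (rule tendsto_sandwich[where f="\<lambda>_. 0" and h="\<lambda>n. ennreal (2 powr p) *
      ((\<integral>\<^sup>+u. ennreal (\<bar>f u - step_fun (xs n) u\<bar> powr p) \<partial>lborel) +
       (\<integral>\<^sup>+u. ennreal (\<bar>f u - step_fun (ys n) u\<bar> powr p) \<partial>lborel))"])
    show "\<forall>\<^sub>F n in sequentially. (\<integral>\<^sup>+u. ennreal (\<bar>step_fun (zs n) u\<bar> powr p) \<partial>lborel) \<le> ennreal (2 powr p) *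
      ((\<integral>\<^sup>+u. ennreal (\<bar>f u - step_fun (xs n) u\<bar> powr p) \<partial>lborel) +
       (\<integral>\<^sup>+u. ennreal (\<bar>f u - step_fun (ys n) u\<bar> powr p) \<partial>lborel))"
    proof (intro always_eventually allI)
      fix n
      have "(\<integral>\<^sup>+u. ennreal (\<bar>step_fun (zs n) u\<bar> powr p) \<partial>lborel) \<le>
        (\<integral>\<^sup>+u. ennreal (2 powr p) * (ennreal (\<bar>f u - step_fun (xs n) u\<bar> powr p) + ennreal (\<bar>f u - step_fun (ys n) u\<bar> powr p)) \<partial>lborel)"
      proof (rule nn_integral_mono)
        fix u
        have "\<bar>step_fun (zs n) u\<bar> powr p \<le> 2 powr p * (\<bar>f u - step_fun (ys n) u\<bar> powr p + \<bar>f u - step_fun (xs n) u\<bar> powr p)"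
          using abs_diff_powr_le[of p "f u - step_fun (ys n) u" "f u - step_fun (xs n) u"] index
          by (simp add: zs_def step_fun_append_negate)
        then show "ennreal (\<bar>step_fun (zs n) u\<bar> powr p) \<le> ennreal (2 powr p) *
          (ennreal (\<bar>f u - step_fun (xs n) u\<bar> powr p) + ennreal (\<bar>f u - step_fun (ys n) u\<bar> powr p))"
          by (simp add: ennreal_plus[symmetric] ennreal_mult[symmetric] ennreal_leI add.commute del: ennreal_plus)
      qed
      also have "\<dots> = ennreal (2 powr p) *
      ((\<integral>\<^sup>+u. ennreal (\<bar>f u - step_fun (xs n) u\<bar> powr p) \<partial>lborel) +
       (\<integral>\<^sup>+u. ennreal (\<bar>f u - step_fun (ys n) u\<bar> powr p) \<partial>lborel))"
        by (simp add: nn_integral_cmult nn_integral_add)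
      finally show "(\<integral>\<^sup>+u. ennreal (\<bar>step_fun (zs n) u\<bar> powr p) \<partial>lborel) \<le> \<dots>" .
    qed
    have "(\<lambda>n. ennreal (2 powr p) *
      ((\<integral>\<^sup>+u. ennreal (\<bar>f u - step_fun (xs n) u\<bar> powr p) \<partial>lborel) +
       (\<integral>\<^sup>+u. ennreal (\<bar>f u - step_fun (ys n) u\<bar> powr p) \<partial>lborel))) \<longlonglongrightarrow> ennreal (2 powr p) * (0 + 0)"
      by (intro ennreal_tendsto_cmult tendsto_add xs ys) simp
    then show "(\<lambda>n. ennreal (2 powr p) *
      ((\<integral>\<^sup>+u. ennreal (\<bar>f u - step_fun (xs n) u\<bar> powr p) \<partial>lborel) +
       (\<integral>\<^sup>+u. ennreal (\<bar>f u - step_fun (ys n) u\<bar> powr p) \<partial>lborel))) \<longlonglongrightarrow> 0"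
      by simp
  qed auto
  then have "tendsto_in_probability M (\<lambda>n. step_integral L (zs n)) (\<lambda>_. 0)"
    by (intro step_integral_tendsto_0) (simp add: zs_def valid_steps_append_negate xs ys)
  then have "tendsto_in_probability M (\<lambda>n \<omega>. step_integral L (xs n) \<omega> - step_integral L (ys n) \<omega>) (\<lambda>_. 0)"
    by (simp add: zs_def step_integral_append_negate[abs_def])
  with xs ys Y Z show ?thesis
    by (intro AE_eq_if_tendsto_in_probability[of "\<lambda>n. step_integral L (xs n)" "\<lambda>n. step_integral L (ys n)"]
          step_integral_measurable) (auto simp: has_stable_integral_def)
qed

subsection \<open>Riemann sums as stable integrals\<close>

text \<open>By homogeneity the coefficients are the values of the integrand at the left ends of n+1
  equal cells of \<open>[0, t]\<close>, so the step integral is exactly a Riemann sum of the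
  path.\<close>

definition beta_steps :: "real \<Rightarrow> real \<Rightarrow> real \<Rightarrow> nat \<Rightarrow> (real \<times> real \<times> real) list" where
  "beta_steps a b t n = map (\<lambda>i. (t powr (a + b) * beta_kernel a b (of_nat i / of_nat (Suc n)),
     t * (of_nat i / of_nat (Suc n)), t * (of_nat (Suc i) / of_nat (Suc n)))) [0..<Suc n]"

lemma valid_beta_steps: "0 \<le> t \<Longrightarrow> valid_steps (beta_steps a b t n)"
  by (auto simp: valid_steps_def beta_steps_def simp del: upt_Suc intro!: mult_left_mono divide_right_mono)

lemma step_integral_beta_steps:
  "step_integral L (beta_steps a b t n) \<omega> = t powr (a + b) * beta_riemann_sum a b (\<lambda>v. L (t * v) \<omega>) n"
  unfolding step_integral_def beta_steps_def beta_riemann_sum_def sum_distrib_left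
  by (simp add: interv_sum_list_conv_sum_set_nat lessThan_atLeast0 mult.assoc comp_def del: upt_Suc of_nat_Suc sum.lessThan_Suc sum.op_ivl_Suc)

lemma step_fun_beta_steps:
  "step_fun (beta_steps a b t n) u = (\<Sum>i<Suc n. t powr (a + b) * beta_kernel a b (of_nat i / of_nat (Suc n))
     * indicat_real {t * (of_nat i / of_nat (Suc n))<..t * (of_nat (Suc i) / of_nat (Suc n))} u)"
  unfolding step_fun_def beta_steps_def
  by (simp add: interv_sum_list_conv_sum_set_nat lessThan_atLeast0 mult.assoc comp_def del: upt_Suc of_nat_Suc sum.lessThan_Suc sum.op_ivl_Suc)

lemma step_fun_beta_steps_outside:
  assumes "0 \<le> t" "u \<le> 0 \<or> t < u"
  shows "step_fun (beta_steps a b t n) u = 0"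
  unfolding step_fun_beta_steps
proof (rule sum.neutral, rule ballI)
  fix i assume "i \<in> {..<Suc n}"
  then have "t * (of_nat (Suc i) / of_nat (Suc n)) \<le> t * 1"
    using assms by (intro mult_left_mono) auto
  moreover have "0 \<le> t * (of_nat i / of_nat (Suc n))"
    using assms by simp
  moreover have "indicat_real {l<..r} u = 0" if "r \<le> t * 1" "0 \<le> l" for l r
    using that assms by (auto simp: indicator_def)
  ultimately show "t powr (a + b) * beta_kernel a b (of_nat i / of_nat (Suc n))
     * indicat_real {t * (of_nat i / of_nat (Suc n))<..t * (of_nat (Suc i) / of_nat (Suc n))} u = 0"
    by (simp only: mult_zero_right)
qed

lemma step_fun_beta_steps_inside:
  assumes u: "0 < u" "u \<le> t"
  obtains w where "0 \<le> w" "w \<le> u / t" "u / t - 1 / of_nat (Suc n) \<le> w"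
    "step_fun (beta_steps a b t n) u = t powr (a + b) * beta_kernel a b w"
proof -
  have t: "0 < t" using u by simp
  define N where "N = real (Suc n)"
  have N: "0 < N" by (simp add: N_def)
  \<comment> \<open>Index of the cell containing \<open>u\<close>. The cells are open on the left
    and closed on the right, hence the ceiling minus one and not the floor; the witness
    \<open>w\<close> is the left end of the rescaled cell.\<close>
  define j where "j = nat (\<lceil>u / t * N\<rceil> - 1)"
  have pos: "0 < u / t * N" "u / t * N \<le> N"
    using u t N by (auto simp: divide_le_eq)
  then have "1 \<le> \<lceil>u / t * N\<rceil>"
    by linarith
  then have j_eq: "real j = of_int \<lceil>u / t * N\<rceil> - 1"
    by (simp add: j_def)
  then have j: "real j < u / t * N" "u / t * N \<le> real j + 1"
    by linarith+
  then have "real j < N"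
    using pos by linarith
  then have jn: "j < Suc n"
    by (simp add: N_def)
  have in_iff: "u \<in> {t * (real i / N)<..t * (real (Suc i) / N)} \<longleftrightarrow> i = j" for i
  proof -
    have "u \<in> {t * (real i / N)<..t * (real (Suc i) / N)} \<longleftrightarrow> real i < u / t * N \<and> u / t * N \<le> real i + 1"
      using t N by (auto simp: field_simps)
    also have "\<dots> \<longleftrightarrow> i = j"
      using j by auto
    finally show ?thesis .
  qed
  have "step_fun (beta_steps a b t n) u = (\<Sum>i<Suc n. if i = j then t powr (a + b) * beta_kernel a b (real j / N) else 0)"
    unfolding step_fun_beta_steps N_def[symmetric] indicator_def in_iff by (intro sum.cong refl) simp
  also have "\<dots> = t powr (a + b) * beta_kernel a b (real j / N)"
    using jn by simp
  finally have "step_fun (beta_steps a b t n) u = t powr (a + b) * beta_kernel a b (real j / N)" .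
  moreover have "real j / N \<le> u / t" "u / t - 1 / N \<le> real j / N" "0 \<le> real j / N"
  proof -
    show "real j / N \<le> u / t" "0 \<le> real j / N"
      using j N by (simp_all add: divide_le_eq)
    have "u / t \<le> (real j + 1) / N"
      using j N by (simp add: le_divide_eq)
    then show "u / t - 1 / N \<le> real j / N"
      by (simp add: add_divide_distrib)
  qed
  ultimately show ?thesis
    unfolding N_def using that by blast
qed

lemma beta_kernel_bounds:
  assumes "0 \<le> a" "0 \<le> b" "0 \<le> v" "v \<le> 1"
  shows "0 \<le> beta_kernel a b v" "beta_kernel a b v \<le> 1"
  using assms by (auto simp: beta_kernel_def intro!: mult_le_one powr_le1)

lemma powr_mult_powr_eq_beta_kernel:
  assumes "0 \<le> u" "u \<le> t" "0 < t"
  shows "u powr a * (t - u) powr b = t powr (a + b) * beta_kernel a b (u / t)"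
proof -
  have "u powr a = t powr a * (u / t) powr a"
    using assms by (simp add: powr_divide)
  moreover have "(t - u) powr b = (t * (1 - u / t)) powr b"
    using assms by (simp add: right_diff_distrib)
  then have "(t - u) powr b = t powr b * (1 - u / t) powr b"
    using assms by (simp add: powr_mult)
  ultimately show ?thesis
    by (simp add: beta_kernel_def powr_add)
qed

text \<open>The sampling points converge to \<open>u / t\<close>, so continuity of the kernel gives
  pointwise convergence. As the kernel takes values in [0, 1], the error is at most
  \<open>t powr (a + b)\<close> and lives on \<open>[0, t]\<close>, which permits dominated
  convergence.\<close>

lemma beta_steps_tendsto_powr_norm:
  assumes ab: "0 < a" "0 < b" and t: "0 \<le> t" and p: "0 < p"
  shows "(\<lambda>n. \<integral>\<^sup>+u. ennreal (\<bar>indicat_real {0..t} u * (u powr a * (t - u) powr b)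
      - step_fun (beta_steps a b t n) u\<bar> powr p) \<partial>lborel) \<longlonglongrightarrow> 0"
proof -
  define d where "d n u = \<bar>indicat_real {0..t} u * (u powr a * (t - u) powr b) - step_fun (beta_steps a b t n) u\<bar>" for n u
  define K where "K = t powr (a + b)"
  have K: "0 \<le> K" by (simp add: K_def)
  \<comment> \<open>At \<open>u = 0\<close> the indicator is 1, but \<open>0 powr a = 0\<close>
    makes the integrand vanish.\<close>
  have d_outside: "d n u = 0" if "u \<le> 0 \<or> t < u" for n u
    using that t ab by (auto simp: d_def step_fun_beta_steps_outside indicator_def)
  have d_inside: "d n u \<le> K \<and> (\<lambda>n. d n u) \<longlonglongrightarrow> 0" if u: "0 < u" "u \<le> t" for n u
  proof -
    have t': "0 < t" and v: "0 < u / t" "u / t \<le> 1"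
      using u by auto
    have "\<exists>w. 0 \<le> w \<and> w \<le> u / t \<and> u / t - 1 / of_nat (Suc n) \<le> w \<and>
        step_fun (beta_steps a b t n) u = K * beta_kernel a b w" for n
      unfolding K_def by (rule step_fun_beta_steps_inside[OF u]) blast
    then obtain w where w: "\<And>n. 0 \<le> w n" "\<And>n. w n \<le> u / t" "\<And>n. u / t - 1 / of_nat (Suc n) \<le> w n"
        "\<And>n. step_fun (beta_steps a b t n) u = K * beta_kernel a b (w n)"
      by metis
    have d_eq: "d n u = K * \<bar>beta_kernel a b (u / t) - beta_kernel a b (w n)\<bar>" for n
      using u t' K by (simp add: d_def w(4) powr_mult_powr_eq_beta_kernel[OF less_imp_le] K_def[symmetric]
          abs_mult flip: right_diff_distrib)
    have w1: "w n \<le> 1" for n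
      using w(2)[of n] v by simp
    have "\<bar>beta_kernel a b (u / t) - beta_kernel a b (w n)\<bar> \<le> 1"
      using beta_kernel_bounds[of a b "u / t"] beta_kernel_bounds[of a b "w n"] ab v w(1)[of n] w1[of n] by auto
    then have "d n u \<le> K * 1"
      unfolding d_eq using K by (rule mult_left_mono)
    have "(\<lambda>n. u / t - 1 / of_nat (Suc n)) \<longlonglongrightarrow> u / t - 0"
      by (intro tendsto_intros LIMSEQ_Suc lim_1_over_n)
    then have "w \<longlonglongrightarrow> u / t"
      using w by (intro tendsto_sandwich[of "\<lambda>n. u / t - 1 / of_nat (Suc n)" w _ "\<lambda>_. u / t"]) auto
    then have "(\<lambda>n. beta_kernel a b (w n)) \<longlonglongrightarrow> beta_kernel a b (u / t)"
      by (rule continuous_on_tendsto_compose[OF continuous_on_beta_kernel[OF ab]])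
         (use v w w1 in \<open>auto intro: always_eventually\<close>)
    then have "(\<lambda>n. d n u) \<longlonglongrightarrow> K * \<bar>beta_kernel a b (u / t) - beta_kernel a b (u / t)\<bar>"
      unfolding d_eq by (intro tendsto_intros)
    with \<open>d n u \<le> K * 1\<close> show ?thesis
      by simp
  qed
  have "(\<lambda>n. \<integral>\<^sup>+u. ennreal (d n u powr p) \<partial>lborel) \<longlonglongrightarrow> (\<integral>\<^sup>+u. ennreal 0 \<partial>(lborel :: real measure))"
  proof (rule nn_integral_dominated_convergence[where u="\<lambda>n u. ennreal (d n u powr p)"
        and u'="\<lambda>_. ennreal 0" and w="\<lambda>u. ennreal (K powr p) * indicator {0..t} u"])
    show "AE u in lborel. ennreal (d n u powr p) \<le> ennreal (K powr p) * indicator {0..t} u" for n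
    proof (rule AE_I2)
      fix u
      have "d n u powr p \<le> K powr p" if "0 < u" "u \<le> t"
        using d_inside[OF that, of n] p by (intro powr_mono2) (auto simp: d_def)
      then show "ennreal (d n u powr p) \<le> ennreal (K powr p) * indicator {0..t} u"
        using d_outside[of u n] by (cases "0 < u \<and> u \<le> t") (auto simp: ennreal_leI)
    qed
    show "(\<integral>\<^sup>+u. ennreal (K powr p) * indicator {0..t} u \<partial>lborel) < \<infinity>"
      using t by (simp add: nn_integral_cmult_indicator ennreal_mult_less_top)
    show "AE u in lborel. (\<lambda>n. ennreal (d n u powr p)) \<longlonglongrightarrow> ennreal 0"
    proof (intro AE_I2 tendsto_ennrealI)
      fix u
      have "(\<lambda>n. d n u) \<longlonglongrightarrow> 0"
        using d_outside[of u] d_inside[of u] by (cases "0 < u \<and> u \<le> t") auto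
      then have "(\<lambda>n. d n u powr p) \<longlonglongrightarrow> 0 powr p"
        using p by (intro tendsto_powr') (auto simp: d_def)
      then show "(\<lambda>n. d n u powr p) \<longlonglongrightarrow> 0"
        by simp
    qed
  qed (unfold d_def, measurable)
  then show ?thesis
    by (simp add: d_def)
qed

context right_skewed_stable_levy_process
begin

lemma step_integral_beta_steps_tendsto:
  assumes ab: "0 < a" "0 < b" and t: "0 \<le> t" and \<omega>: "cadlag (\<lambda>t. L t \<omega>)"
  shows "(\<lambda>n. step_integral L (beta_steps a b t n) \<omega>)
    \<longlonglongrightarrow> t powr (a + b) * pathwise_beta_integral a b (\<lambda>t. L t \<omega>) t"
  unfolding step_integral_beta_steps by (intro tendsto_mult tendsto_const beta_riemann_sum_tendsto[OF ab \<omega> t])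

text \<open>The pathwise expression is controlled only on cadlag paths and its measurability is not
  known beforehand, so it enters through a measurable \<open>Y\<close> that equals it almost
  everywhere.\<close>

lemma has_stable_integral_beta_kernel:
  assumes ab: "0 < a" "0 < b" and t: "0 \<le> t" and Y: "Y \<in> borel_measurable M"
    and Y_eq: "AE \<omega> in M. Y \<omega> = t powr (a + b) * pathwise_beta_integral a b (\<lambda>t. L t \<omega>) t"
  shows "has_stable_integral M p L {0..t} (\<lambda>u. u powr a * (t - u) powr b) Y"
  unfolding has_stable_integral_def
proof (intro conjI exI[of _ "beta_steps a b t"] allI)
  show "set_borel_measurable lborel {0..t} (\<lambda>u. u powr a * (t - u) powr b)"
    unfolding set_borel_measurable_def by measurable
  show "tendsto_in_probability M (\<lambda>n. step_integral L (beta_steps a b t n)) Y"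
  proof (rule tendsto_in_probability_if_AE)
    show "AE \<omega> in M. (\<lambda>n. step_integral L (beta_steps a b t n) \<omega>) \<longlonglongrightarrow> Y \<omega>"
      using cadlag_paths Y_eq
      by eventually_elim (simp add: step_integral_beta_steps_tendsto[OF ab t])
  qed (use Y t in \<open>auto intro: step_integral_measurable valid_beta_steps\<close>)
qed (use Y t ab index in \<open>auto intro: valid_beta_steps beta_steps_tendsto_powr_norm\<close>)

text \<open>
  \<open>M\<close> need not be complete, so the version is set to zero on a measurable null set that contains
  all paths that are not cadlag.
\<close>

lemma continuous_version_exists:
  assumes ab: "0 < a" "0 < b"
  obtains Z :: "real \<Rightarrow> 'a \<Rightarrow> real" where
    "\<And>t. 0 \<le> t \<Longrightarrow> Z t \<in> borel_measurable M"
    "\<And>\<omega>. continuous_on {0..} (\<lambda>t. Z t \<omega>)"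
    "\<And>t. 0 \<le> t \<Longrightarrow> AE \<omega> in M. (\<lambda>n. step_integral L (beta_steps a b t n) \<omega>) \<longlonglongrightarrow> Z t \<omega>"
    "\<And>t. 0 \<le> t \<Longrightarrow> has_stable_integral M p L {0..t} (\<lambda>u. u powr a * (t - u) powr b) (Z t)"
proof -
  obtain N where N: "N \<in> null_sets M" "{\<omega> \<in> space M. \<not> cadlag (\<lambda>t. L t \<omega>)} \<subseteq> N"
    using cadlag_paths by (rule AE_E) (auto simp: null_sets_def)
  define G where "G = space M - N"
  have [measurable]: "G \<in> events"
    using N by (auto simp: G_def)
  have G: "cadlag (\<lambda>t. L t \<omega>)" if "\<omega> \<in> G" for \<omega>
    using N that by (auto simp: G_def)
  have AE_G: "AE \<omega> in M. \<omega> \<in> G"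
    using AE_not_in[OF N(1)] AE_space by eventually_elim (simp add: G_def)
  define Z where "Z t \<omega> = indicat_real G \<omega> * (t powr (a + b) * pathwise_beta_integral a b (\<lambda>t. L t \<omega>) t)" for t \<omega>
  \<comment> \<open>Measurability comes from the step integrals: multiplied by the indicator of
    \<open>G\<close> they converge to \<open>Z t\<close> at every point, trivially off
    \<open>G\<close>.\<close>
  have meas: "Z t \<in> borel_measurable M" if t: "0 \<le> t" for t
  proof (rule borel_measurable_LIMSEQ_real)
    show "(\<lambda>n. indicat_real G \<omega> * step_integral L (beta_steps a b t n) \<omega>) \<longlonglongrightarrow> Z t \<omega>" for \<omega>
      unfolding Z_def using step_integral_beta_steps_tendsto[OF ab t G]
      by (cases "\<omega> \<in> G") (auto intro!: tendsto_intros)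
    show "(\<lambda>\<omega>. indicat_real G \<omega> * step_integral L (beta_steps a b t n) \<omega>) \<in> borel_measurable M" for n
      using step_integral_measurable[OF valid_beta_steps[OF t]] by measurable
  qed
  have Z_eq: "AE \<omega> in M. Z t \<omega> = t powr (a + b) * pathwise_beta_integral a b (\<lambda>t. L t \<omega>) t" for t
    using AE_G by eventually_elim (simp add: Z_def)
  have cont: "continuous_on {0..} (\<lambda>t. Z t \<omega>)" for \<omega>
  proof (cases "\<omega> \<in> G")
    case True
    then show ?thesis
      unfolding Z_def using ab
      by (intro continuous_intros continuous_on_powr' continuous_on_pathwise_beta_integral G) auto
  qed (simp add: Z_def)
  show ?thesis
  proof (rule that)
    show "AE \<omega> in M. (\<lambda>n. step_integral L (beta_steps a b t n) \<omega>) \<longlonglongrightarrow> Z t \<omega>" if "0 \<le> t" for t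
      using cadlag_paths Z_eq[of t]
      by eventually_elim (simp add: step_integral_beta_steps_tendsto[OF ab that])
    show "has_stable_integral M p L {0..t} (\<lambda>u. u powr a * (t - u) powr b) (Z t)" if "0 \<le> t" for t
      by (rule has_stable_integral_beta_kernel[OF ab that meas[OF that] Z_eq])
  qed (fact meas cont)+
qed

end

subsection \<open>Limits of finite-dimensional distributions\<close>

text \<open>Continuous approximations of the indicator of a closed set: their expectations survive
  almost sure limits, which those of indicators need not. \<open>infdist\<close> to the empty set is
  0, so an empty \<open>C\<close> gives the constant 1.\<close>

definition closed_cutoff :: "real set \<Rightarrow> nat \<Rightarrow> real \<Rightarrow> real" where
  "closed_cutoff C m x = max 0 (1 - of_nat m * infdist x C)"

lemma continuous_closed_cutoff: "continuous_on A (closed_cutoff C m)"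
  unfolding closed_cutoff_def by (intro continuous_intros)

lemma closed_cutoff_measurable [measurable]: "closed_cutoff C m \<in> borel_measurable borel"
  by (rule borel_measurable_continuous_onI[OF continuous_closed_cutoff])

lemma closed_cutoff_bounds: "0 \<le> closed_cutoff C m x" "closed_cutoff C m x \<le> 1"
  by (auto simp: closed_cutoff_def infdist_nonneg)

lemma closed_cutoff_tendsto:
  assumes "closed C" "C \<noteq> {}"
  shows "(\<lambda>m. closed_cutoff C m x) \<longlonglongrightarrow> indicator C x"
proof (cases "x \<in> C")
  case True
  then show ?thesis by (simp add: closed_cutoff_def)
next
  case False
  then have pos: "0 < infdist x C"
    using assms in_closed_iff_infdist_zero[of C x] infdist_nonneg[of x C] by linarith
  have "eventually (\<lambda>m. 1 / infdist x C \<le> of_nat m) sequentially"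
    by (meson eventually_at_top_linorder of_nat_mono order.trans real_arch_simple)
  then have "eventually (\<lambda>m. closed_cutoff C m x = 0) sequentially"
    by eventually_elim (use pos in \<open>simp add: closed_cutoff_def divide_le_eq\<close>)
  then show ?thesis
    using False by (simp add: tendsto_eventually)
qed

text \<open>Closed boxes are stable under intersection, so this generator reduces equality of laws
  to the probabilities of closed boxes.\<close>

lemma sets_PiM_borel_eq_closed:
  fixes J :: "'i set"
  assumes "finite J"
  shows "sets (PiM J (\<lambda>_. borel :: real measure)) =
    sigma_sets (PiE J (\<lambda>_. UNIV)) {PiE J C | C. \<forall>j\<in>J. closed (C j)}"
proof -
  have "sets (PiM J (\<lambda>_. borel :: real measure)) = sets (PiM J (\<lambda>_. sigma UNIV (Collect closed)))"
    by (simp add: borel_eq_closed)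
  also have "\<dots> = sets (sigma (PiE J (\<lambda>_. UNIV))
      {{f \<in> PiE J (\<lambda>_. UNIV). \<forall>i\<in>j. f i \<in> A i} | A j. j \<in> {J} \<and> A \<in> Pi j (\<lambda>_. Collect closed)})"
    by (rule sets_PiM_sigma) (use assms in \<open>auto intro!: exI[of _ "{UNIV}"]\<close>)
  also have "{{f \<in> PiE J (\<lambda>_. UNIV). \<forall>i\<in>j. f i \<in> A i} | A j. j \<in> {J} \<and> A \<in> Pi j (\<lambda>_. Collect closed)}
    = {PiE J C | C. \<forall>j\<in>J. closed (C j :: real set)}"
    by (intro Collect_cong ex_cong1) (auto simp: PiE_iff Pi_iff extensional_def)
  also have "sets (sigma (PiE J (\<lambda>_. UNIV)) \<dots>) = sigma_sets (PiE J (\<lambda>_. UNIV)) \<dots>"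
    by (rule sets_measure_of) (auto simp: PiE_def)
  finally show ?thesis .
qed

lemma (in prob_space) prod_cutoff_tendsto_prob:
  assumes "finite J" and Z[measurable]: "\<And>j. j \<in> J \<Longrightarrow> random_variable borel (Z j)"
    and C: "\<And>j. j \<in> J \<Longrightarrow> closed (C j)" "\<And>j. j \<in> J \<Longrightarrow> C j \<noteq> {}"
  shows "(\<lambda>m. expectation (\<lambda>\<omega>. \<Prod>j\<in>J. closed_cutoff (C j) m (Z j \<omega>)))
    \<longlonglongrightarrow> prob {\<omega> \<in> space M. \<forall>j\<in>J. Z j \<omega> \<in> C j}"
proof -
  have [measurable]: "C j \<in> sets borel" if "j \<in> J" for j
    using C(1)[OF that] by (rule borel_closed)
  have set[measurable]: "{\<omega> \<in> space M. \<forall>j\<in>J. Z j \<omega> \<in> C j} \<in> events"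
    using \<open>finite J\<close> by measurable
  have "(\<lambda>m. expectation (\<lambda>\<omega>. \<Prod>j\<in>J. closed_cutoff (C j) m (Z j \<omega>)))
    \<longlonglongrightarrow> expectation (indicat_real {\<omega> \<in> space M. \<forall>j\<in>J. Z j \<omega> \<in> C j})"
  proof (rule integral_dominated_convergence[where w="\<lambda>_. 1"])
    show "AE \<omega> in M. (\<lambda>m. \<Prod>j\<in>J. closed_cutoff (C j) m (Z j \<omega>))
      \<longlonglongrightarrow> indicat_real {\<omega> \<in> space M. \<forall>j\<in>J. Z j \<omega> \<in> C j} \<omega>"
    proof (rule AE_I2)
      fix \<omega> assume "\<omega> \<in> space M"
      have "(\<lambda>m. \<Prod>j\<in>J. closed_cutoff (C j) m (Z j \<omega>)) \<longlonglongrightarrow> (\<Prod>j\<in>J. indicat_real (C j) (Z j \<omega>))"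
        by (intro tendsto_prod closed_cutoff_tendsto C)
      also have "(\<Prod>j\<in>J. indicat_real (C j) (Z j \<omega>)) = indicat_real {\<omega> \<in> space M. \<forall>j\<in>J. Z j \<omega> \<in> C j} \<omega>"
        using \<open>finite J\<close> \<open>\<omega> \<in> space M\<close> by (auto simp: indicator_def prod_zero_iff)
      finally show "(\<lambda>m. \<Prod>j\<in>J. closed_cutoff (C j) m (Z j \<omega>))
        \<longlonglongrightarrow> indicat_real {\<omega> \<in> space M. \<forall>j\<in>J. Z j \<omega> \<in> C j} \<omega>" .
    qed
    show "AE \<omega> in M. norm (\<Prod>j\<in>J. closed_cutoff (C j) m (Z j \<omega>)) \<le> 1" for m
      using closed_cutoff_bounds by (intro AE_I2) (simp add: abs_prod prod_le_1)
  qed (auto intro!: borel_measurable_prod)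
  then show ?thesis
    by simp
qed

text \<open>Two limits in succession: for a fixed cutoff level \<open>m\<close> the expectations
  pass to the limit in \<open>n\<close> by continuity, then \<open>m\<close> tends to infinity and
  yields the probabilities of closed boxes, which determine the law.\<close>

lemma (in prob_space) distr_PiM_eq_if_AE_tendsto:
  fixes X Y :: "nat \<Rightarrow> 'i \<Rightarrow> 'a \<Rightarrow> real"
  assumes J: "finite J"
    and X[measurable]: "\<And>n j. j \<in> J \<Longrightarrow> random_variable borel (X n j)"
    and Y[measurable]: "\<And>n j. j \<in> J \<Longrightarrow> random_variable borel (Y n j)"
    and U[measurable]: "\<And>j. j \<in> J \<Longrightarrow> random_variable borel (U j)"
    and V[measurable]: "\<And>j. j \<in> J \<Longrightarrow> random_variable borel (V j)"
    and XU: "\<And>j. j \<in> J \<Longrightarrow> AE \<omega> in M. (\<lambda>n. X n j \<omega>) \<longlonglongrightarrow> U j \<omega>"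
    and YV: "\<And>j. j \<in> J \<Longrightarrow> AE \<omega> in M. (\<lambda>n. Y n j \<omega>) \<longlonglongrightarrow> V j \<omega>"
    and eq: "\<And>n. distr M (PiM J (\<lambda>_. borel)) (\<lambda>\<omega>. \<lambda>j\<in>J. X n j \<omega>)
      = distr M (PiM J (\<lambda>_. borel)) (\<lambda>\<omega>. \<lambda>j\<in>J. Y n j \<omega>)"
  shows "distr M (PiM J (\<lambda>_. borel)) (\<lambda>\<omega>. \<lambda>j\<in>J. U j \<omega>) = distr M (PiM J (\<lambda>_. borel)) (\<lambda>\<omega>. \<lambda>j\<in>J. V j \<omega>)"
proof -
  have lim: "(\<lambda>n. expectation (\<lambda>\<omega>. \<Prod>j\<in>J. closed_cutoff (C j) m (Z n j \<omega>)))
    \<longlonglongrightarrow> expectation (\<lambda>\<omega>. \<Prod>j\<in>J. closed_cutoff (C j) m (W j \<omega>))"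
    if [measurable]: "\<And>n j. j \<in> J \<Longrightarrow> random_variable borel (Z n j)" "\<And>j. j \<in> J \<Longrightarrow> random_variable borel (W j)"
      and ZW: "\<And>j. j \<in> J \<Longrightarrow> AE \<omega> in M. (\<lambda>n. Z n j \<omega>) \<longlonglongrightarrow> W j \<omega>"
    for C m and Z :: "nat \<Rightarrow> 'i \<Rightarrow> 'a \<Rightarrow> real" and W :: "'i \<Rightarrow> 'a \<Rightarrow> real"
  proof (rule integral_dominated_convergence[where w="\<lambda>_. 1"])
    have "AE \<omega> in M. \<forall>j\<in>J. (\<lambda>n. Z n j \<omega>) \<longlonglongrightarrow> W j \<omega>"
      using ZW J by (simp add: AE_finite_all)
    then show "AE \<omega> in M. (\<lambda>n. \<Prod>j\<in>J. closed_cutoff (C j) m (Z n j \<omega>)) \<longlonglongrightarrow> (\<Prod>j\<in>J. closed_cutoff (C j) m (W j \<omega>))"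
      by eventually_elim
         (auto intro!: tendsto_prod continuous_on_tendsto_compose[OF continuous_closed_cutoff[of UNIV]])
    show "AE \<omega> in M. norm (\<Prod>j\<in>J. closed_cutoff (C j) m (Z n j \<omega>)) \<le> 1" for n
      using closed_cutoff_bounds by (intro AE_I2) (simp add: abs_prod prod_le_1)
  qed (auto intro!: borel_measurable_prod)
  have expect_eq: "expectation (\<lambda>\<omega>. \<Prod>j\<in>J. closed_cutoff (C j) m (X n j \<omega>))
      = expectation (\<lambda>\<omega>. \<Prod>j\<in>J. closed_cutoff (C j) m (Y n j \<omega>))" for C m n
  proof -
    have *: "expectation (\<lambda>\<omega>. \<Prod>j\<in>J. closed_cutoff (C j) m (Z j \<omega>))
      = (\<integral>z. (\<Prod>j\<in>J. closed_cutoff (C j) m (z j)) \<partial>distr M (PiM J (\<lambda>_. borel)) (\<lambda>\<omega>. \<lambda>j\<in>J. Z j \<omega>))"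
      if [measurable]: "\<And>j. j \<in> J \<Longrightarrow> random_variable borel (Z j)" for Z
    proof (subst integral_distr)
      show "(\<lambda>\<omega>. \<lambda>j\<in>J. Z j \<omega>) \<in> M \<rightarrow>\<^sub>M PiM J (\<lambda>_. borel)"
        by (rule measurable_restrict) measurable
      show "(\<lambda>z. \<Prod>j\<in>J. closed_cutoff (C j) m (z j)) \<in> borel_measurable (PiM J (\<lambda>_. borel))"
        by (intro borel_measurable_prod measurable_compose[OF measurable_component_singleton]) auto
    qed simp
    show ?thesis
      using X Y eq by (simp add: *)
  qed
  have prob_eq: "prob {\<omega> \<in> space M. \<forall>j\<in>J. U j \<omega> \<in> C j} = prob {\<omega> \<in> space M. \<forall>j\<in>J. V j \<omega> \<in> C j}"
    if C: "\<And>j. j \<in> J \<Longrightarrow> closed (C j)" for C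
  proof (cases "\<exists>j\<in>J. C j = {}")
    case False
    have "expectation (\<lambda>\<omega>. \<Prod>j\<in>J. closed_cutoff (C j) m (U j \<omega>)) = expectation (\<lambda>\<omega>. \<Prod>j\<in>J. closed_cutoff (C j) m (V j \<omega>))" for m
      using lim[of X U C m, OF X U XU]
        lim[of Y V C m, OF Y V YV] unfolding expect_eq by (rule LIMSEQ_unique)
    then show ?thesis
      using prod_cutoff_tendsto_prob[of J U C] prod_cutoff_tendsto_prob[of J V C] J U V C False
      by (auto intro: LIMSEQ_unique)
  next
    \<comment> \<open>An empty factor is excluded from the cutoff argument because its cutoff is
      constantly 1; here both events are empty.\<close>
    case True
    then show ?thesis
      by (intro arg_cong[where f=prob]) auto
  qed
  have meas[measurable]: "(\<lambda>\<omega>. \<lambda>j\<in>J. U j \<omega>) \<in> M \<rightarrow>\<^sub>M PiM J (\<lambda>_. borel)" "(\<lambda>\<omega>. \<lambda>j\<in>J. V j \<omega>) \<in> M \<rightarrow>\<^sub>M PiM J (\<lambda>_. borel)"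
    by (rule measurable_restrict, measurable)+
  let ?E = "{PiE J C | C. \<forall>j\<in>J. closed (C j :: real set)}"
  show ?thesis
  proof (rule measure_eqI_generator_eq[where \<Omega>="PiE J (\<lambda>_. UNIV)" and E="?E" and A="\<lambda>_. PiE J (\<lambda>_. UNIV)"])
    show "Int_stable ?E"
    proof (rule Int_stableI)
      fix A B assume "A \<in> ?E" "B \<in> ?E"
      then obtain C D where "A = PiE J C" "B = PiE J D" "\<forall>j\<in>J. closed (C j)" "\<forall>j\<in>J. closed (D j)"
        by auto
      then have "A \<inter> B = PiE J (\<lambda>j. C j \<inter> D j)" "\<forall>j\<in>J. closed (C j \<inter> D j)"
        by (auto simp: PiE_Int)
      then show "A \<inter> B \<in> ?E"
        by blast
    qed
    show "?E \<subseteq> Pow (PiE J (\<lambda>_. UNIV))"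
      by auto
    fix A assume "A \<in> ?E"
    then obtain C where A: "A = PiE J C" "\<And>j. j \<in> J \<Longrightarrow> closed (C j)"
      by auto
    have [measurable]: "A \<in> sets (PiM J (\<lambda>_. borel))"
      unfolding A(1) using J A(2) by (intro sets_PiM_I_finite) (auto intro: borel_closed)
    have "(\<lambda>\<omega>. \<lambda>j\<in>J. Z j \<omega>) -` A \<inter> space M = {\<omega> \<in> space M. \<forall>j\<in>J. Z j \<omega> \<in> C j}" for Z :: "'i \<Rightarrow> 'a \<Rightarrow> real"
      by (auto simp: A(1) PiE_iff)
    then show "emeasure (distr M (PiM J (\<lambda>_. borel)) (\<lambda>\<omega>. \<lambda>j\<in>J. U j \<omega>)) A
      = emeasure (distr M (PiM J (\<lambda>_. borel)) (\<lambda>\<omega>. \<lambda>j\<in>J. V j \<omega>)) A"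
      using prob_eq[of C] A(2) by (simp add: emeasure_distr emeasure_eq_measure)
  next
    show "range (\<lambda>_. PiE J (\<lambda>_. UNIV)) \<subseteq> ?E"
      by (auto intro!: exI[of _ "\<lambda>_. UNIV"])
    show "emeasure (distr M (PiM J (\<lambda>_. borel)) (\<lambda>\<omega>. \<lambda>j\<in>J. U j \<omega>)) (PiE J (\<lambda>_. UNIV)) \<noteq> \<infinity>"
      by (subst emeasure_distr) (auto simp: emeasure_eq_measure intro!: sets_PiM_I_finite J)
  qed (use sets_PiM_borel_eq_closed[OF J] in auto)
qed

subsection \<open>Self-similarity\<close>

context right_skewed_stable_levy_process
begin

text \<open>The exponent is linear in the length of the interval and homogeneous of degree
  \<open>p\<close> in \<theta>, so stretching time by \<open>c\<close> acts like multiplication by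
  \<open>c powr (1 / p)\<close>.\<close>

lemma distr_increment_scale:
  assumes c: "0 < c" and st: "0 \<le> s" "s \<le> t"
  shows "distr M borel (\<lambda>\<omega>. L (c * t) \<omega> - L (c * s) \<omega>)
    = distr M borel (\<lambda>\<omega>. c powr (1 / p) * (L t \<omega> - L s \<omega>))"
proof (rule Levy_uniqueness)
  have cst: "0 \<le> c * s" "c * s \<le> c * t"
    using assms by auto
  show "real_distribution (distr M borel (\<lambda>\<omega>. L (c * t) \<omega> - L (c * s) \<omega>))"
    by (intro real_distribution_distr increment_measurable cst)
  show "real_distribution (distr M borel (\<lambda>\<omega>. c powr (1 / p) * (L t \<omega> - L s \<omega>)))"
    using increment_measurable[OF st] by (intro real_distribution_distr) simp
  show "char (distr M borel (\<lambda>\<omega>. L (c * t) \<omega> - L (c * s) \<omega>))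
    = char (distr M borel (\<lambda>\<omega>. c powr (1 / p) * (L t \<omega> - L s \<omega>)))"
  proof
    fix \<theta>
    have "(c powr (1 / p)) powr p = c"
      using c index by (simp add: powr_powr)
    then show "char (distr M borel (\<lambda>\<omega>. L (c * t) \<omega> - L (c * s) \<omega>)) \<theta>
      = char (distr M borel (\<lambda>\<omega>. c powr (1 / p) * (L t \<omega> - L s \<omega>))) \<theta>"
      using char_increment_scaled[OF cst, of 1 \<theta>] char_increment_scaled[OF st, of "c powr (1 / p)" \<theta>] c
        stable_exponent_scale[of "c powr (1 / p)" p \<theta>]
      by (simp add: algebra_simps)
  qed
qed

text \<open>Independence makes both joint laws products of their marginals, so the one-dimensional
  scaling suffices. The product criterion is for nonempty index sets, hence the case
  \<open>n = 0\<close>.\<close>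

lemma distr_increments_scale:
  fixes t :: "nat \<Rightarrow> real"
  assumes c: "0 < c" and t: "mono t" "0 \<le> t 0"
  shows "distr M (PiM {..<n} (\<lambda>_. borel)) (\<lambda>\<omega>. \<lambda>i\<in>{..<n}. L (c * t (Suc i)) \<omega> - L (c * t i) \<omega>)
    = distr M (PiM {..<n} (\<lambda>_. borel)) (\<lambda>\<omega>. \<lambda>i\<in>{..<n}. c powr (1 / p) * (L (t (Suc i)) \<omega> - L (t i) \<omega>))"
proof (cases "n = 0")
  case False
  have pos: "0 \<le> t i" "t i \<le> t (Suc i)" for i
    using t monoD[OF t(1), of 0 i] monoD[OF t(1), of i "Suc i"] by auto
  define V where "V i \<omega> = L (c * t (Suc i)) \<omega> - L (c * t i) \<omega>" for i \<omega>
  define W where "W i \<omega> = c powr (1 / p) * (L (t (Suc i)) \<omega> - L (t i) \<omega>)" for i \<omega>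
  have "indep_vars (\<lambda>_. borel) V {..<n}"
    unfolding V_def using indep_increments[of "\<lambda>i. c * t i" n] c pos by (simp add: mult_left_mono)
  moreover have "indep_vars (\<lambda>_. borel) W {..<n}"
    unfolding W_def by (rule indep_vars_compose2[OF indep_increments]) (use pos in auto)
  moreover have "V i \<in> borel_measurable M" "W i \<in> borel_measurable M" for i
    using increment_measurable[of "c * t i" "c * t (Suc i)"] increment_measurable[of "t i" "t (Suc i)"] c pos
    by (auto simp: V_def[abs_def] W_def[abs_def])
  ultimately have
    "distr M (PiM {..<n} (\<lambda>_. borel)) (\<lambda>\<omega>. \<lambda>i\<in>{..<n}. V i \<omega>) = PiM {..<n} (\<lambda>i. distr M borel (V i))"
    "distr M (PiM {..<n} (\<lambda>_. borel)) (\<lambda>\<omega>. \<lambda>i\<in>{..<n}. W i \<omega>) = PiM {..<n} (\<lambda>i. distr M borel (W i))"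
    using False indep_vars_iff_distr_eq_PiM[of "{..<n}" V "\<lambda>_. borel"]
      indep_vars_iff_distr_eq_PiM[of "{..<n}" W "\<lambda>_. borel"] by (auto simp: lessThan_empty_iff)
  moreover have "distr M borel (V i) = distr M borel (W i)" for i
    unfolding V_def[abs_def] W_def[abs_def] by (rule distr_increment_scale[OF c pos])
  ultimately show ?thesis
    unfolding V_def[symmetric] W_def[symmetric] by (simp only:)
qed (simp add: restrict_def)

text \<open>On a partition common to all the lists, both random vectors are images of the increment
  vector under one linear map \<open>h\<close>, so equality of the increment laws transfers.\<close>

lemma distr_step_integrals_scale:
  assumes c: "0 < c" and J: "finite J" and xs: "\<And>j. j \<in> J \<Longrightarrow> valid_steps (xs j)"
  shows "distr M (PiM J (\<lambda>_. borel)) (\<lambda>\<omega>. \<lambda>j\<in>J. d * step_integral (\<lambda>t. L (c * t)) (xs j) \<omega>)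
    = distr M (PiM J (\<lambda>_. borel)) (\<lambda>\<omega>. \<lambda>j\<in>J. d * (c powr (1 / p) * step_integral L (xs j) \<omega>))"
proof -
  have "finite (\<Union>j\<in>J. breakpoints (xs j))" "(\<Union>j\<in>J. breakpoints (xs j)) \<subseteq> {0..}"
    using J(1) finite_breakpoints UN_least[of J "\<lambda>j. breakpoints (xs j)" "{0..}"] breakpoints_nonneg[OF xs]
    by simp_all
  then obtain t :: "nat \<Rightarrow> real" and n where t: "mono t" "0 \<le> t 0"
      and bp: "(\<Union>j\<in>J. breakpoints (xs j)) \<subseteq> t ` {..n}"
    by (rule finite_subset_range_mono)
  have pos: "0 \<le> t i" "t i \<le> t (Suc i)" for i
    using t monoD[OF t(1), of 0 i] monoD[OF t(1), of i "Suc i"] by auto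
  define h where "h z = (\<lambda>j\<in>J. d * (\<Sum>i<n. step_fun (xs j) (t (Suc i)) * z i))" for z :: "nat \<Rightarrow> real"
  define V where "V \<omega> = (\<lambda>i\<in>{..<n}. L (c * t (Suc i)) \<omega> - L (c * t i) \<omega>)" for \<omega>
  define W where "W \<omega> = (\<lambda>i\<in>{..<n}. c powr (1 / p) * (L (t (Suc i)) \<omega> - L (t i) \<omega>))" for \<omega>
  have sum_eq: "step_integral L' (xs j) \<omega> = (\<Sum>i<n. step_fun (xs j) (t (Suc i)) * (L' (t (Suc i)) \<omega> - L' (t i) \<omega>))"
    if "j \<in> J" for j \<omega> and L' :: "real \<Rightarrow> 'a \<Rightarrow> real"
    by (rule step_integral_eq_sum_partition[OF t(1) xs[OF that]]) (use bp that in blast)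
  have hV: "(\<lambda>j\<in>J. d * step_integral (\<lambda>t. L (c * t)) (xs j) \<omega>) = h (V \<omega>)" for \<omega>
    unfolding h_def V_def by (intro restrict_ext) (simp add: sum_eq)
  have hW: "(\<lambda>j\<in>J. d * (c powr (1 / p) * step_integral L (xs j) \<omega>)) = h (W \<omega>)" for \<omega>
    unfolding h_def W_def by (intro restrict_ext) (simp add: sum_eq sum_distrib_left mult_ac)
  have [measurable]: "h \<in> PiM {..<n} (\<lambda>_. borel) \<rightarrow>\<^sub>M PiM J (\<lambda>_. borel)"
    unfolding h_def
    by (intro measurable_restrict borel_measurable_times borel_measurable_sum measurable_const
        measurable_component_singleton) auto
  have [measurable]: "V \<in> M \<rightarrow>\<^sub>M PiM {..<n} (\<lambda>_. borel)"
    unfolding V_def[abs_def] by (intro measurable_restrict increment_measurable) (use c pos in auto)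
  have [measurable]: "W \<in> M \<rightarrow>\<^sub>M PiM {..<n} (\<lambda>_. borel)"
    unfolding W_def[abs_def]
    by (intro measurable_restrict borel_measurable_times measurable_const increment_measurable pos) simp
  have "distr M (PiM J (\<lambda>_. borel)) (\<lambda>\<omega>. h (V \<omega>)) = distr (distr M (PiM {..<n} (\<lambda>_. borel)) V) (PiM J (\<lambda>_. borel)) h"
    by (simp add: distr_distr comp_def)
  also have "\<dots> = distr (distr M (PiM {..<n} (\<lambda>_. borel)) W) (PiM J (\<lambda>_. borel)) h"
    using distr_increments_scale[OF c t, of n] by (simp add: V_def[abs_def] W_def[abs_def])
  also have "\<dots> = distr M (PiM J (\<lambda>_. borel)) (\<lambda>\<omega>. h (W \<omega>))"
    by (simp add: distr_distr comp_def)
  finally show ?thesis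
    unfolding hV hW .
qed

text \<open>An identity for each \<omega>: the grid for \<open>c * t\<close> is the dilated grid for
  \<open>t\<close>, and the kernel coefficients are homogeneous of degree
  \<open>a + b\<close>.\<close>

lemma step_integral_beta_steps_scale:
  assumes "0 < c" "0 \<le> t"
  shows "step_integral L (beta_steps a b (c * t) n) \<omega>
    = c powr (a + b) * step_integral (\<lambda>s. L (c * s)) (beta_steps a b t n) \<omega>"
  using assms by (simp add: step_integral_beta_steps powr_mult mult.assoc)

text \<open>Only almost sure convergence at each fixed time is asked, so the lemma applies to the
  given process itself and not merely to its continuous modification.\<close>

lemma self_similar_beta_integral:
  assumes \<zeta>: "\<And>t. 0 \<le> t \<Longrightarrow> \<zeta> t \<in> borel_measurable M"
    and lim: "\<And>t. 0 \<le> t \<Longrightarrow> AE \<omega> in M. (\<lambda>n. step_integral L (beta_steps a b t n) \<omega>) \<longlonglongrightarrow> \<zeta> t \<omega>"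
  shows "self_similar M (a + b + 1 / p) \<zeta>"
  unfolding self_similar_def
proof (intro allI impI)
  fix c :: real and J :: "real set"
  assume c: "0 < c" and J: "finite J" "J \<subseteq> {0..}"
  define X where "X n t = step_integral L (beta_steps a b (c * t) n)" for n t
  define Y where "Y n t \<omega> = c powr (a + b) * (c powr (1 / p) * step_integral L (beta_steps a b t n) \<omega>)" for n t \<omega>
  have nonneg: "0 \<le> t" "0 \<le> c * t" if "t \<in> J" for t
    using J c that by auto
  show "fin_dim_distr M (\<lambda>t. \<zeta> (c * t)) J = fin_dim_distr M (\<lambda>t \<omega>. c powr (a + b + 1 / p) * \<zeta> t \<omega>) J"
    unfolding fin_dim_distr_def
  proof (rule distr_PiM_eq_if_AE_tendsto[where X=X and Y=Y])
    fix n
    have "(\<lambda>\<omega>. \<lambda>t\<in>J. X n t \<omega>) = (\<lambda>\<omega>. \<lambda>t\<in>J. c powr (a + b) * step_integral (\<lambda>s. L (c * s)) (beta_steps a b t n) \<omega>)"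
      using c nonneg by (intro ext restrict_ext) (simp add: X_def step_integral_beta_steps_scale)
    then show "distr M (PiM J (\<lambda>_. borel)) (\<lambda>\<omega>. \<lambda>t\<in>J. X n t \<omega>) = distr M (PiM J (\<lambda>_. borel)) (\<lambda>\<omega>. \<lambda>t\<in>J. Y n t \<omega>)"
      unfolding Y_def using distr_step_integrals_scale[OF c J(1), of "\<lambda>t. beta_steps a b t n"] nonneg
      by (simp add: valid_beta_steps)
  next
    fix t assume t: "t \<in> J"
    show "X n t \<in> borel_measurable M" for n
      unfolding X_def by (intro step_integral_measurable valid_beta_steps nonneg[OF t])
    show "Y n t \<in> borel_measurable M" for n
      using step_integral_measurable[OF valid_beta_steps[OF nonneg(1)[OF t]], of a b n] by (simp add: Y_def[abs_def])
    show "\<zeta> (c * t) \<in> borel_measurable M" "(\<lambda>\<omega>. c powr (a + b + 1 / p) * \<zeta> t \<omega>) \<in> borel_measurable M"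
      using \<zeta> nonneg[OF t] by auto
    show "AE \<omega> in M. (\<lambda>n. X n t \<omega>) \<longlonglongrightarrow> \<zeta> (c * t) \<omega>"
      unfolding X_def by (rule lim[OF nonneg(2)[OF t]])
    show "AE \<omega> in M. (\<lambda>n. Y n t \<omega>) \<longlonglongrightarrow> c powr (a + b + 1 / p) * \<zeta> t \<omega>"
      using lim[OF nonneg(1)[OF t]] unfolding Y_def powr_add[of c "a + b"] mult.assoc
      by eventually_elim (intro tendsto_intros)
  qed fact
qed

end

theorem proposition2p9:
  fixes M :: "'a measure" and L \<zeta> :: "real \<Rightarrow> 'a \<Rightarrow> real" and \<alpha> \<beta> :: real
  assumes "0 < \<alpha>" and "\<alpha> < \<beta>" and "\<beta> < 1"
    and "right_skewed_stable_levy_process M L (1 + \<beta>)"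
    and "\<And>t. 0 \<le> t \<Longrightarrow> \<zeta> t \<in> borel_measurable M"
    and "\<And>t. 0 \<le> t \<Longrightarrow> AE \<omega> in M. \<zeta> t \<omega> =
           stable_integral M (1 + \<beta>) L {0..t}
             (\<lambda>u. u powr (\<alpha> / (1 + \<beta>)) * (t - u) powr \<alpha>) \<omega>"
  shows "(\<exists>\<zeta>'. is_modification M \<zeta> \<zeta>' \<and>
            (\<forall>\<omega>\<in>space M. continuous_on {0..} (\<lambda>t. \<zeta>' t \<omega>))) \<and>
         self_similar M ((1 + \<alpha> * (2 + \<beta>)) / (1 + \<beta>)) \<zeta>"
proof -
  interpret right_skewed_stable_levy_process M L "1 + \<beta>"
    by fact
  define a where "a = \<alpha> / (1 + \<beta>)"
  have a: "0 < a"
    using assms(1-3) by (simp add: a_def)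
  obtain Z where Z: "\<And>t. 0 \<le> t \<Longrightarrow> Z t \<in> borel_measurable M"
    "\<And>\<omega>. continuous_on {0..} (\<lambda>t. Z t \<omega>)"
    "\<And>t. 0 \<le> t \<Longrightarrow> AE \<omega> in M. (\<lambda>n. step_integral L (beta_steps a \<alpha> t n) \<omega>) \<longlonglongrightarrow> Z t \<omega>"
    "\<And>t. 0 \<le> t \<Longrightarrow> has_stable_integral M (1 + \<beta>) L {0..t} (\<lambda>u. u powr a * (t - u) powr \<alpha>) (Z t)"
    using continuous_version_exists[OF a \<open>0 < \<alpha>\<close>] by blast
  \<comment> \<open>\<open>Z t\<close> witnesses that an integral exists, so the value chosen by
    \<open>SOME\<close> is an integral too, and uniqueness identifies the two almost surely.\<close>
  have Z_eq: "AE \<omega> in M. Z t \<omega> = \<zeta> t \<omega>" if t: "0 \<le> t" for t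
  proof -
    have "has_stable_integral M (1 + \<beta>) L {0..t} (\<lambda>u. u powr a * (t - u) powr \<alpha>)
        (stable_integral M (1 + \<beta>) L {0..t} (\<lambda>u. u powr a * (t - u) powr \<alpha>))"
      unfolding stable_integral_def by (rule someI[where P="has_stable_integral M (1 + \<beta>) L {0..t} _", OF Z(4)[OF t]])
    from has_stable_integral_unique[OF Z(4)[OF t] this] assms(6)[OF t] show ?thesis
      by eventually_elim (simp add: a_def)
  qed
  have "is_modification M \<zeta> Z"
    using Z(1) Z_eq by (simp add: is_modification_def)
  moreover have "self_similar M (a + \<alpha> + 1 / (1 + \<beta>)) \<zeta>"
  proof (rule self_similar_beta_integral[OF assms(5)])
    show "AE \<omega> in M. (\<lambda>n. step_integral L (beta_steps a \<alpha> t n) \<omega>) \<longlonglongrightarrow> \<zeta> t \<omega>" if "0 \<le> t" for t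
      using Z(3)[OF that] Z_eq[OF that] by eventually_elim simp
  qed
  moreover have "a + \<alpha> + 1 / (1 + \<beta>) = (1 + \<alpha> * (2 + \<beta>)) / (1 + \<beta>)"
    using assms(1-3) by (simp add: a_def field_simps)
  ultimately show ?thesis
    using Z(2) by auto
qed

end
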